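(* Let $M$ be a finite m-cov random measure over $\mathbb{R}^d$. Then there exist a sequence $(X_n)_{n\in\mathbb{N}}$ of pairwise uncorrelated real random variables with summable variances, $\sum_{n}\mathrm{Var}(X_n)<\infty$, and a linearly independent sequence $(\mu_n)_{n\in\mathbb{N}}$ of finite (real) measures over $\mathbb{R}^d$ such that, for every bounded Borel measurable function $\varphi:\mathbb{R}^d\to\mathbb{R}$, $$\langle M,\varphi\rangle=\sum_{n\in\mathbb{N}}X_n\,\langle\mu_n,\varphi\rangle,$$ the series converging in mean-square, i.e. $\mathbb{E}\big(|\langle M,\varphi\rangle-\sum_{j\le n}X_j\langle\mu_j,\varphi\rangle|^2\big)\to0$ as $n\to\infty$.
   Context: All random variables are real and defined on a common probability space $(\Omega,\mathcal{A},\mathbb{P})$. $\mathcal{B}(\mathbb{R}^d)$ denotes the Borel $\sigma$-algebra and $\mathcal{B}_B(\mathbb{R}^d)$ the $\delta$-ring of bounded Borel sets. A measure over $\mathbb{R}^d$ is a real-valued (signed) $\sigma$-additive function $\mu:\mathcal{B}_B(\mathbb{R}^d)\to\mathbb{R}$ (hence locally finite); $|\mu|$ is its total variation measure, the smallest positive measure with $|\mu(A)|\le|\mu|(A)$ for all $A\in\mathcal{B}_B(\mathbb{R}^d)$. $\mu$ is finite if $|\mu|(\mathbb{R}^d)<\infty$, in which case it extends uniquely and $\sigma$-additively to $\mathcal{B}(\mathbb{R}^d)$. $\langle\mu,\varphi\rangle=\int_{\mathbb{R}^d}\varphi\,d\mu$. A (centred measure-covariance second-order) random measure, called m-cov random measure,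 over $\mathbb{R}^d$ is a zero-mean stochastic process $M=(M(A))_{A\in\mathcal{B}_B(\mathbb{R}^d)}$ for which there is a measure $C_M$ over $\mathbb{R}^d\times\mathbb{R}^d$ (the covariance measure) with $\mathbb{E}(M(A)M(B))=C_M(A\times B)$ for all $A,B\in\mathcal{B}_B(\mathbb{R}^d)$. $M$ is finite if $C_M$ is finite. Write $(\varphi\otimes\phi)(x,y)=\varphi(x)\phi(y)$. For measurable $\varphi:\mathbb{R}^d\to\mathbb{R}$ with $\int|\varphi|\otimes|\varphi|\,d|C_M|<\infty$, $\langle M,\varphi\rangle=\int_{\mathbb{R}^d}\varphi(x)\,dM(x)\in L^2(\Omega,\mathcal{A},\mathbb{P})$ is the (Dunford–Schwartz) integral with respect to the $L^2(\Omega)$-valued measure $A\mapsto M(A)$: it is linear in $\varphi$, equals $M(A)$ for $\varphi=\mathbf{1}_A$, $A\in\mathcal{B}_B(\mathbb{R}^d)$, and is the $L^2(\Omega)$-limit of $\langle M,\varphi_n\rangle$ for any simple functions $\varphi_n$ (linear combinations of indicators of bounded Borel sets) with $\varphi_n\to\varphi$ pointwise and $|\varphi_n|\le|\varphi|$. One has $\mathbb{E}(\langle M,\varphi\rangle\langle M,\phi\rangle)=\langle C_M,\varphi\otimes\phi\rangle$. *)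

theory Defs
  imports "HOL-Probability.Probability"
begin

section \<open>Signed measures on the ring of bounded Borel sets\<close>

definition bounded_borel :: "'a::euclidean_space set set" where
  "bounded_borel = {A \<in> sets borel. bounded A}"

text \<open>A signed measure is a total set function of which only the values on
  \<^const>\<open>bounded_borel\<close> matter; two set functions agreeing there are the same signed measure.\<close>

definition signed_measure :: "('a::euclidean_space set \<Rightarrow> real) \<Rightarrow> bool" where
  "signed_measure \<mu> \<longleftrightarrow>
     (\<forall>A :: nat \<Rightarrow> 'a set. range A \<subseteq> bounded_borel \<longrightarrow> disjoint_family A \<longrightarrow>
        (\<Union>n. A n) \<in> bounded_borel \<longrightarrow> (\<lambda>n. \<mu> (A n)) sums \<mu> (\<Union>n. A n))"

text \<open>A positive measure, i.e.\ a non-negative signed measure, is represented by its unique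
  extension to a Borel measure with values in $[0,\infty]$.\<close>

definition positive_measure :: "'a::euclidean_space measure \<Rightarrow> bool" where
  "positive_measure \<nu> \<longleftrightarrow>
     sets \<nu> = sets borel \<and> (\<forall>A\<in>bounded_borel. emeasure \<nu> A < \<infinity>)"

text \<open>On measures with the same \<open>\<sigma>\<close>-algebra the library's order is the setwise order,
  so \<open>LEAST\<close> is the smallest measure in the usual sense.\<close>

definition total_variation :: "('a::euclidean_space set \<Rightarrow> real) \<Rightarrow> 'a measure" where
  "total_variation \<mu> =
     (LEAST \<nu>. positive_measure \<nu> \<and> (\<forall>A\<in>bounded_borel. ennreal \<bar>\<mu> A\<bar> \<le> emeasure \<nu> A))"

definition finite_signed_measure :: "('a::euclidean_space set \<Rightarrow> real) \<Rightarrow> bool" where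
  "finite_signed_measure \<mu> \<longleftrightarrow> signed_measure \<mu> \<and> emeasure (total_variation \<mu>) UNIV < \<infinity>"

text \<open>The positive part of the Jordan decomposition, \<open>\<mu>\<^sup>+ = sup \<mu> 0\<close>; the negative part
  is the positive part of \<open>- \<mu>\<close>. The function \<^const>\<open>ennreal\<close> truncates negative values to 0.\<close>

definition positive_variation :: "('a::euclidean_space set \<Rightarrow> real) \<Rightarrow> 'a measure" where
  "positive_variation \<mu> =
     (LEAST \<nu>. positive_measure \<nu> \<and> (\<forall>A\<in>bounded_borel. ennreal (\<mu> A) \<le> emeasure \<nu> A))"

definition signed_integral :: "('a::euclidean_space set \<Rightarrow> real) \<Rightarrow> ('a \<Rightarrow> real) \<Rightarrow> real" where
  "signed_integral \<mu> \<phi> =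
     (\<integral>x. \<phi> x \<partial>positive_variation \<mu>) - (\<integral>x. \<phi> x \<partial>positive_variation (\<lambda>A. - \<mu> A))"

definition lin_indep_measures :: "(nat \<Rightarrow> 'a::euclidean_space set \<Rightarrow> real) \<Rightarrow> bool" where
  "lin_indep_measures \<mu> \<longleftrightarrow>
     (\<forall>(c :: nat \<Rightarrow> real) n.
        (\<forall>A\<in>bounded_borel. (\<Sum>i<n. c i * \<mu> i A) = 0) \<longrightarrow> (\<forall>i<n. c i = 0))"


section \<open>Square-integrable random variables\<close>

definition square_integrable :: "'w measure \<Rightarrow> ('w \<Rightarrow> real) \<Rightarrow> bool" where
  "square_integrable P X \<longleftrightarrow> X \<in> borel_measurable P \<and> integrable P (\<lambda>\<omega>. (X \<omega>)\<^sup>2)"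

definition tendsto_mean_square ::
    "'w measure \<Rightarrow> (nat \<Rightarrow> 'w \<Rightarrow> real) \<Rightarrow> ('w \<Rightarrow> real) \<Rightarrow> bool" where
  "tendsto_mean_square P Z Y \<longleftrightarrow>
     (\<forall>n. square_integrable P (Z n)) \<and> square_integrable P Y \<and>
     (\<lambda>n. prob_space.expectation P (\<lambda>\<omega>. \<bar>Y \<omega> - Z n \<omega>\<bar>\<^sup>2)) \<longlonglongrightarrow> 0"

definition uncorrelated :: "'w measure \<Rightarrow> ('w \<Rightarrow> real) \<Rightarrow> ('w \<Rightarrow> real) \<Rightarrow> bool" where
  "uncorrelated P X Y \<longleftrightarrow>
     prob_space.expectation P
       (\<lambda>\<omega>. (X \<omega> - prob_space.expectation P X) * (Y \<omega> - prob_space.expectation P Y)) = 0"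


section \<open>Random measures with a covariance measure\<close>

definition is_covariance_measure ::
    "'w measure \<Rightarrow> ('a::euclidean_space set \<Rightarrow> 'w \<Rightarrow> real) \<Rightarrow> (('a \<times> 'a) set \<Rightarrow> real) \<Rightarrow> bool" where
  "is_covariance_measure P M C \<longleftrightarrow> signed_measure C \<and>
     (\<forall>A\<in>bounded_borel. \<forall>B\<in>bounded_borel.
        prob_space.expectation P (\<lambda>\<omega>. M A \<omega> * M B \<omega>) = C (A \<times> B))"

definition mcov_random_measure ::
    "'w measure \<Rightarrow> ('a::euclidean_space set \<Rightarrow> 'w \<Rightarrow> real) \<Rightarrow> bool" where
  "mcov_random_measure P M \<longleftrightarrow>
     (\<forall>A\<in>bounded_borel. square_integrable P (M A) \<and> prob_space.expectation P (M A) = 0) \<and>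
     (\<exists>C. is_covariance_measure P M C)"

text \<open>The values of a covariance measure on \<^const>\<open>bounded_borel\<close> are determined by those on
  rectangles, so the choice below only concerns irrelevant values.\<close>

definition covariance_measure ::
    "'w measure \<Rightarrow> ('a::euclidean_space set \<Rightarrow> 'w \<Rightarrow> real) \<Rightarrow> ('a \<times> 'a) set \<Rightarrow> real" where
  "covariance_measure P M = (SOME C. is_covariance_measure P M C)"

definition finite_mcov_random_measure ::
    "'w measure \<Rightarrow> ('a::euclidean_space set \<Rightarrow> 'w \<Rightarrow> real) \<Rightarrow> bool" where
  "finite_mcov_random_measure P M \<longleftrightarrow>
     mcov_random_measure P M \<and> finite_signed_measure (covariance_measure P M)"


section \<open>The integral with respect to a random measure\<close>

definition rm_integrable ::
    "'w measure \<Rightarrow> ('a::euclidean_space set \<Rightarrow> 'w \<Rightarrow> real) \<Rightarrow> ('a \<Rightarrow> real) \<Rightarrow> bool" where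
  "rm_integrable P M \<phi> \<longleftrightarrow> \<phi> \<in> borel_measurable borel \<and>
     (\<integral>\<^sup>+(x, y). ennreal (\<bar>\<phi> x\<bar> * \<bar>\<phi> y\<bar>) \<partial>total_variation (covariance_measure P M)) < \<infinity>"

text \<open>A linear combination of indicators of bounded Borel sets.\<close>

definition bounded_simple :: "('a::euclidean_space \<Rightarrow> real) \<Rightarrow> bool" where
  "bounded_simple s \<longleftrightarrow> simple_function borel s \<and> bounded {x. s x \<noteq> 0}"

text \<open>Summation over the non-zero values is the canonical representation. Other
  representations give the same random variable almost surely, since \<open>M\<close> is additive in \<open>L\<^sup>2\<close>.\<close>

definition rm_simple_integral ::
    "('a::euclidean_space set \<Rightarrow> 'w \<Rightarrow> real) \<Rightarrow> ('a \<Rightarrow> real) \<Rightarrow> 'w \<Rightarrow> real" where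
  "rm_simple_integral M s \<omega> = (\<Sum>y\<in>range s - {0}. y * M (s -` {y}) \<omega>)"

definition is_rm_integral ::
    "'w measure \<Rightarrow> ('a::euclidean_space set \<Rightarrow> 'w \<Rightarrow> real) \<Rightarrow> ('a \<Rightarrow> real) \<Rightarrow> ('w \<Rightarrow> real) \<Rightarrow> bool"
  where
  "is_rm_integral P M \<phi> Y \<longleftrightarrow> square_integrable P Y \<and>
     (\<forall>s :: nat \<Rightarrow> 'a \<Rightarrow> real.
        (\<forall>n. bounded_simple (s n)) \<longrightarrow>
        (\<forall>x. (\<lambda>n. s n x) \<longlonglongrightarrow> \<phi> x) \<longrightarrow>
        (\<forall>n x. \<bar>s n x\<bar> \<le> \<bar>\<phi> x\<bar>) \<longrightarrow>
        tendsto_mean_square P (\<lambda>n. rm_simple_integral M (s n)) Y)"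

text \<open>An element of \<open>L\<^sup>2\<close> is an equivalence class of random variables; an arbitrary
  representative is chosen. The value 0 for non-integrable \<open>\<phi>\<close> is a convention.\<close>

definition rm_integral ::
    "'w measure \<Rightarrow> ('a::euclidean_space set \<Rightarrow> 'w \<Rightarrow> real) \<Rightarrow> ('a \<Rightarrow> real) \<Rightarrow> 'w \<Rightarrow> real" where
  "rm_integral P M \<phi> =
     (if rm_integrable P M \<phi> then SOME Y. is_rm_integral P M \<phi> Y else (\<lambda>_. 0))"

end

theory Submission
  imports Defs
begin

text \<open>Let $C$ be the covariance measure of $M$. On bounded Borel functions the form
  $B(\varphi, \psi) = \langle C, \varphi \otimes \psi\rangle$ is a semi-inner product and
  $\varphi \mapsto \langle M, \varphi\rangle$ is an isometry for it. Choose a countable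
  $\cap$-stable generator $(A_k)$ of the Borel sets consisting of bounded sets; the indicators of the
  $A_k$ span a dense subspace, because $B(\varphi, \varphi)$ is dominated by the squared $L^2$ norm over the
  sum of the marginals of $|C|$. If $(f_k)$ is the Gram-Schmidt orthogonalisation of these indicators, then
  \[\langle M, \varphi\rangle = \sum_k \langle M, f_k\rangle \, B(\varphi, f_k) / B(f_k, f_k).\]
  Each $\varphi \mapsto B(\varphi, f_k)$ is integration against a finite signed measure. Shifting a factor
  $2^{-k}$ from this measure to the random coefficient makes the variances summable.\<close>

section \<open>Gram-Schmidt orthogonalisation for semi-inner products\<close>

text \<open>\<open>total_variation\<close> and \<open>positive_variation\<close> are
  \<open>LEAST\<close> elements and \<open>rm_integral\<close> is a \<open>SOME\<close>, so nothing
  is known about them before a witness exists. For the first two the witness is a Jordan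
  decomposition, built from Hahn decompositions of bounded pieces because a
  \<open>signed_measure\<close> lives on bounded sets only and may be unbounded over all of them;
  for the third it is a mean-square limit. The marginals enter through
  \<open>|a * b| \<le> a^2 + b^2\<close>, which replaces a product over two points by squares at one
  point each. Neither symmetry nor positivity of B can be read off its integral formula; both are
  inherited from covariances of random variables. B may be degenerate, even zero, so Gram-Schmidt
  vectors of length zero can occur, yet infinitely many linearly independent measures are required.
  Such an index gets the coefficient 0 and a Dirac measure at a point without mass for the first
  marginal of |C|. The locale is abstract because it is used for three forms: B, its marginal
  majorant and the inner product of random variables.\<close>

locale semi_inner =
  fixes V :: "('a \<Rightarrow> real) set" and B :: "('a \<Rightarrow> real) \<Rightarrow> ('a \<Rightarrow> real) \<Rightarrow> real"
  assumes zero_closed: "(\<lambda>_. 0) \<in> V"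
    and lin_closed: "f \<in> V \<Longrightarrow> g \<in> V \<Longrightarrow> (\<lambda>x. f x + c * g x) \<in> V"
    and lin_left: "f \<in> V \<Longrightarrow> g \<in> V \<Longrightarrow> k \<in> V \<Longrightarrow> B (\<lambda>x. f x + c * g x) k = B f k + c * B g k"
    and sym: "f \<in> V \<Longrightarrow> g \<in> V \<Longrightarrow> B f g = B g f"
    and nonneg: "f \<in> V \<Longrightarrow> 0 \<le> B f f"
begin

lemma lin_right:
  "f \<in> V \<Longrightarrow> g \<in> V \<Longrightarrow> k \<in> V \<Longrightarrow> B k (\<lambda>x. f x + c * g x) = B k f + c * B k g"
  using lin_left[of f g k c] by (simp add: sym lin_closed)

lemma scale_closed: "g \<in> V \<Longrightarrow> (\<lambda>x. c * g x) \<in> V"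
  using lin_closed[OF zero_closed, of g c] by simp

lemma zero_left: "k \<in> V \<Longrightarrow> B (\<lambda>_. 0) k = 0"
  using lin_left[OF zero_closed zero_closed, of k 1] by simp

lemma diff_closed: "f \<in> V \<Longrightarrow> g \<in> V \<Longrightarrow> (\<lambda>x. f x - g x) \<in> V"
  using lin_closed[of f g "-1"] by simp

lemma diff_left: "f \<in> V \<Longrightarrow> g \<in> V \<Longrightarrow> k \<in> V \<Longrightarrow> B (\<lambda>x. f x - g x) k = B f k - B g k"
  using lin_left[of f g k "-1"] by simp

lemma diff_right: "f \<in> V \<Longrightarrow> g \<in> V \<Longrightarrow> k \<in> V \<Longrightarrow> B k (\<lambda>x. f x - g x) = B k f - B k g"
  using lin_right[of f g k "-1"] by simp

lemma add_closed: "f \<in> V \<Longrightarrow> g \<in> V \<Longrightarrow> (\<lambda>x. f x + g x) \<in> V"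
  using lin_closed[of f g 1] by simp

lemma sum_closed:
  "finite J \<Longrightarrow> (\<And>j. j \<in> J \<Longrightarrow> f j \<in> V) \<Longrightarrow> (\<lambda>x. \<Sum>j\<in>J. c j * f j x) \<in> V"
  by (induction J rule: finite_induct) (auto simp: zero_closed intro!: add_closed scale_closed)

lemma sum_left:
  assumes "finite J" "\<And>j. j \<in> J \<Longrightarrow> f j \<in> V" "k \<in> V"
  shows "B (\<lambda>x. \<Sum>j\<in>J. c j * f j x) k = (\<Sum>j\<in>J. c j * B (f j) k)"
  using assms(1,2)
proof (induction J rule: finite_induct)
  case empty
  show ?case using assms(3) by (simp add: zero_left)
next
  case (insert i J)
  have *: "(\<lambda>x. \<Sum>j\<in>J. c j * f j x) \<in> V" "f i \<in> V" using insert by (auto intro!: sum_closed)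
  have "B (\<lambda>x. (\<Sum>j\<in>J. c j * f j x) + c i * f i x) k = B (\<lambda>x. \<Sum>j\<in>J. c j * f j x) k + c i * B (f i) k"
    using * assms(3) by (rule lin_left)
  then show ?case using insert by (simp add: add.commute)
qed

lemma form_lin:
  assumes "f \<in> V" "g \<in> V"
  shows "B (\<lambda>x. f x + c * g x) (\<lambda>x. f x + c * g x) = B f f + 2 * c * B f g + c\<^sup>2 * B g g"
  using assms sym[of f g]
  by (simp add: lin_left lin_right lin_closed power2_eq_square algebra_simps)

lemma form_diff:
  assumes "f \<in> V" "g \<in> V"
  shows "B (\<lambda>x. f x - g x) (\<lambda>x. f x - g x) = B f f - 2 * B f g + B g g"
  using form_lin[OF assms, of "-1"] by simp

lemma form_diff_sum:
  assumes "finite J" "\<And>j. j \<in> J \<Longrightarrow> f j \<in> V" "v \<in> V"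
  shows "B (\<lambda>x. v x - (\<Sum>j\<in>J. c j * f j x)) (\<lambda>x. v x - (\<Sum>j\<in>J. c j * f j x)) =
    B v v - 2 * (\<Sum>j\<in>J. c j * B (f j) v) + (\<Sum>i\<in>J. \<Sum>j\<in>J. c i * (c j * B (f i) (f j)))"
proof -
  let ?p = "\<lambda>x. \<Sum>j\<in>J. c j * f j x"
  have p: "?p \<in> V" using assms by (intro sum_closed)
  have "B ?p k = (\<Sum>j\<in>J. c j * B (f j) k)" if "k \<in> V" for k
    using assms that by (intro sum_left)
  moreover have "B (f i) ?p = (\<Sum>j\<in>J. c j * B (f i) (f j))" if "i \<in> J" for i
    using assms that sum_left[OF assms(1), of f "f i" c]
    by (subst sym[OF _ p]) (auto intro!: sum.cong simp: sym[of "f i"])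
  ultimately show ?thesis
    using form_diff[OF assms(3) p] sym[OF assms(3) p] p assms(3) by (simp add: sum_distrib_left)
qed

text \<open>The parallelogram law for a = f - g and b = g - k with the nonnegative term B(a - b, a -
  b) dropped. It serves as the triangle inequality throughout and avoids square roots.\<close>

lemma form_diff_triangle:
  assumes "f \<in> V" "g \<in> V" "k \<in> V"
  shows "B (\<lambda>x. f x - k x) (\<lambda>x. f x - k x) \<le>
    2 * B (\<lambda>x. f x - g x) (\<lambda>x. f x - g x) + 2 * B (\<lambda>x. g x - k x) (\<lambda>x. g x - k x)"
proof -
  let ?a = "\<lambda>x. f x - g x" and ?b = "\<lambda>x. g x - k x"
  have ab: "?a \<in> V" "?b \<in> V" using assms by (auto intro: diff_closed)
  have "0 \<le> B (\<lambda>x. ?a x - ?b x) (\<lambda>x. ?a x - ?b x)" using nonneg[OF diff_closed[OF ab]] .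
  moreover have "(\<lambda>x. ?a x + 1 * ?b x) = (\<lambda>x. f x - k x)" by auto
  ultimately show ?thesis using form_lin[OF ab, of 1] form_diff[OF ab] by simp
qed

lemma cauchy_schwarz:
  assumes "f \<in> V" "g \<in> V"
  shows "(B f g)\<^sup>2 \<le> B f f * B g g"
proof (cases "B g g = 0")
  case True
  have "B f g = 0"
  proof (rule ccontr)
    assume ne: "B f g \<noteq> 0"
    \<comment> \<open>With \<open>B g g = 0\<close> the form at f + c g is affine in c; this c
      brings it to the value -1.\<close>
    let ?c = "- (B f f + 1) / (2 * B f g)"
    have "0 \<le> B f f + 2 * ?c * B f g + ?c\<^sup>2 * B g g"
      using nonneg[OF lin_closed[OF assms, of ?c]] form_lin[OF assms, of ?c] by simp
    also have "\<dots> = -1" using ne True by (simp add: field_simps)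
    finally show False by simp
  qed
  then show ?thesis using True by simp
next
  case False
  then have pos: "B g g > 0" using nonneg[OF assms(2)] by simp
  \<comment> \<open>The minimiser of the quadratic polynomial c \<mapsto> B(f + c g, f + c
    g).\<close>
  let ?c = "- B f g / B g g"
  have "0 \<le> B f f + 2 * ?c * B f g + ?c\<^sup>2 * B g g"
    using nonneg[OF lin_closed[OF assms, of ?c]] form_lin[OF assms, of ?c] by simp
  also have "\<dots> = B f f - (B f g)\<^sup>2 / B g g"
    using pos by (simp add: field_simps power2_eq_square)
  finally show ?thesis using pos by (simp add: field_simps)
qed

text \<open>A vector of length zero is orthogonal to everything. This is what makes division by a
  zero length harmless in the projections below.\<close>

lemma form_degenerate: "f \<in> V \<Longrightarrow> g \<in> V \<Longrightarrow> B g g = 0 \<Longrightarrow> B f g = 0"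
  using cauchy_schwarz[of f g] by simp

lemma form_tendsto_zero:
  assumes "\<And>n. x n \<in> V" "\<And>n. y n \<in> V"
    and "(\<lambda>n. B (x n) (x n)) \<longlonglongrightarrow> 0" "(\<lambda>n. B (y n) (y n)) \<longlonglongrightarrow> l"
  shows "(\<lambda>n. B (x n) (y n)) \<longlonglongrightarrow> 0"
proof -
  have "(\<lambda>n. (B (x n) (y n))\<^sup>2) \<longlonglongrightarrow> 0"
  proof (rule tendsto_sandwich[OF _ _ tendsto_const])
    show "(\<lambda>n. B (x n) (x n) * B (y n) (y n)) \<longlonglongrightarrow> 0"
      using tendsto_mult[OF assms(3,4)] by simp
  qed (use assms in \<open>auto intro!: always_eventually cauchy_schwarz\<close>)
  then show ?thesis by simp
qed

text \<open>Joint continuity: expanding B(x, y) around (a, b) leaves three terms, each with a null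
  sequence in one argument, so that Cauchy-Schwarz disposes of them.\<close>

lemma form_tendsto:
  assumes "\<And>n. x n \<in> V" "\<And>n. y n \<in> V" "a \<in> V" "b \<in> V"
    and x: "(\<lambda>n. B (\<lambda>t. x n t - a t) (\<lambda>t. x n t - a t)) \<longlonglongrightarrow> 0"
    and y: "(\<lambda>n. B (\<lambda>t. y n t - b t) (\<lambda>t. y n t - b t)) \<longlonglongrightarrow> 0"
  shows "(\<lambda>n. B (x n) (y n)) \<longlonglongrightarrow> B a b"
proof -
  note [simp] = assms(1-4)
  have "(\<lambda>n. B (\<lambda>t. x n t - a t) (\<lambda>t. y n t - b t) + B (\<lambda>t. x n t - a t) b +
      B (\<lambda>t. y n t - b t) a + B a b) \<longlonglongrightarrow> 0 + 0 + 0 + B a b"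
    by (intro tendsto_add form_tendsto_zero[OF _ _ x y] form_tendsto_zero[OF _ _ x tendsto_const]
        form_tendsto_zero[OF _ _ y tendsto_const] tendsto_const diff_closed) auto
  moreover have "B (\<lambda>t. x n t - a t) (\<lambda>t. y n t - b t) + B (\<lambda>t. x n t - a t) b +
      B (\<lambda>t. y n t - b t) a + B a b = B (x n) (y n)" for n
    using sym[of a "y n"] sym[of a b] by (simp add: diff_left diff_right diff_closed)
  ultimately show ?thesis by simp
qed

text \<open>Division by zero yields 0, so a degenerate vector simply drops out of the projection.\<close>

fun gram_schmidt :: "(nat \<Rightarrow> 'a \<Rightarrow> real) \<Rightarrow> nat \<Rightarrow> 'a \<Rightarrow> real" where
  "gram_schmidt z k = (\<lambda>x. z k x - (\<Sum>j<k.
     (B (z k) (gram_schmidt z j) / B (gram_schmidt z j) (gram_schmidt z j)) * gram_schmidt z j x))"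

declare gram_schmidt.simps [simp del]

lemma gram_schmidt_closed: "(\<And>k. z k \<in> V) \<Longrightarrow> gram_schmidt z k \<in> V"
proof (induction k rule: less_induct)
  case (less k)
  then show ?case
    by (subst gram_schmidt.simps) (intro diff_closed sum_closed; simp)
qed

lemma project_orthogonal:
  fixes f :: "nat \<Rightarrow> 'a \<Rightarrow> real"
  assumes f: "\<And>k. f k \<in> V" and "v \<in> V" "i < n"
    and orth: "\<And>i j. i < n \<Longrightarrow> j < n \<Longrightarrow> i \<noteq> j \<Longrightarrow> B (f i) (f j) = 0"
  shows "B (\<lambda>x. v x - (\<Sum>j<n. (B v (f j) / B (f j) (f j)) * f j x)) (f i) = 0"
proof -
  have "(\<Sum>j<n. (B v (f j) / B (f j) (f j)) * B (f j) (f i)) =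
      (\<Sum>j<n. if j = i then (B v (f i) / B (f i) (f i)) * B (f i) (f i) else 0)"
    using orth \<open>i < n\<close> by (intro sum.cong) auto
  \<comment> \<open>If \<open>B (f i) (f i) = 0\<close>, the left side is 0 by the division
    convention, and so is the right side by \<open>form_degenerate\<close>.\<close>
  also have "\<dots> = B v (f i)"
    using \<open>i < n\<close> form_degenerate[OF \<open>v \<in> V\<close> f[of i]]
    by (subst sum.delta) auto
  finally show ?thesis
    using f \<open>v \<in> V\<close> by (subst diff_left) (auto simp del: times_divide_eq_left simp: sum_closed sum_left)
qed

lemma gram_schmidt_orthogonal:
  assumes "\<And>k. z k \<in> V" "i \<noteq> j"
  shows "B (gram_schmidt z i) (gram_schmidt z j) = 0"
proof -
  \<comment> \<open>All pairs below k are treated at once, because projecting \<open>z k\<close>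
    needs the orthogonality of all earlier vectors among each other.\<close>
  have less: "\<forall>i j. i < k \<longrightarrow> j < k \<longrightarrow> i \<noteq> j \<longrightarrow> B (gram_schmidt z i) (gram_schmidt z j) = 0" for k
  proof (induction k)
    case (Suc k)
    have "B (gram_schmidt z k) (gram_schmidt z i) = 0" if "i < k" for i
      by (subst gram_schmidt.simps[of z k], rule project_orthogonal)
         (use Suc that assms in \<open>auto intro: gram_schmidt_closed\<close>)
    then show ?case
      using Suc sym[OF gram_schmidt_closed[where z=z] gram_schmidt_closed[where z=z]] assms(1)
      by (auto simp: less_Suc_eq)
  qed simp
  show ?thesis using less[of "Suc (max i j)"] assms(2) by (simp add: less_Suc_eq_le)
qed

text \<open>By construction \<open>z k\<close> is \<open>gram_schmidt z k\<close> plus a combination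
  of earlier vectors, so orthogonality to the new vectors passes back to the original ones.\<close>

lemma orthogonal_gram_schmidt:
  assumes z: "\<And>k. z k \<in> V" and "v \<in> V" "\<And>j. j \<le> k \<Longrightarrow> B v (gram_schmidt z j) = 0"
  shows "B v (z k) = 0"
proof -
  let ?p = "\<lambda>x. \<Sum>j<k. (B (z k) (gram_schmidt z j) / B (gram_schmidt z j) (gram_schmidt z j)) * gram_schmidt z j x"
  have p: "?p \<in> V" using z by (intro sum_closed gram_schmidt_closed) auto
  have "B v ?p = B ?p v" using \<open>v \<in> V\<close> p by (rule sym)
  also have "\<dots> = 0"
    using assms by (subst sum_left) (auto intro!: gram_schmidt_closed sum.neutral simp: sym[of _ v] gram_schmidt_closed)
  finally have "B v ?p = 0" .
  moreover have "B v (gram_schmidt z k) = B v (z k) - B v ?p"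
    by (subst gram_schmidt.simps) (use p z \<open>v \<in> V\<close> in \<open>simp add: diff_right\<close>)
  ultimately show ?thesis using assms(3)[of k] by simp
qed

text \<open>Adding one multiple at a time gives an induction rule directly, without index sets or
  coefficient families.\<close>

inductive_set lin_span :: "(nat \<Rightarrow> 'a \<Rightarrow> real) \<Rightarrow> ('a \<Rightarrow> real) set" for z where
  zero: "(\<lambda>_. 0) \<in> lin_span z"
| step: "u \<in> lin_span z \<Longrightarrow> (\<lambda>x. u x + c * z k x) \<in> lin_span z"

lemma lin_span_closed: "u \<in> lin_span z \<Longrightarrow> (\<And>k. z k \<in> V) \<Longrightarrow> u \<in> V"
  by (induction rule: lin_span.induct) (auto intro: zero_closed lin_closed)

lemma lin_span_base: "z k \<in> lin_span z"
  using lin_span.step[OF lin_span.zero, of 1 z k] by simp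

lemma lin_span_lin:
  assumes "u \<in> lin_span z" "v \<in> lin_span z"
  shows "(\<lambda>x. u x + a * v x) \<in> lin_span z"
  using assms(2)
proof (induction rule: lin_span.induct)
  case (step v c k)
  from lin_span.step[OF step.IH, of "a * c" k] show ?case by (simp add: algebra_simps)
qed (simp add: assms(1))

text \<open>An element of the span involves only finitely many generators. Of a coefficient
  representation only this cut-off n is kept.\<close>

lemma lin_span_orthogonal:
  assumes "u \<in> lin_span z" and z: "\<And>k. z k \<in> V"
  shows "\<exists>n. \<forall>v\<in>V. (\<forall>k<n. B v (z k) = 0) \<longrightarrow> B v u = 0"
  using assms(1)
proof (induction rule: lin_span.induct)
  case zero
  show ?case using zero_left sym[OF _ zero_closed] by auto
next
  case (step u c k)
  then obtain n where n: "\<forall>v\<in>V. (\<forall>k<n. B v (z k) = 0) \<longrightarrow> B v u = 0" by blast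
  have "u \<in> V" using step z by (blast intro: lin_span_closed)
  then show ?case using n z by (intro exI[of _ "max n (Suc k)"]) (auto simp: lin_right)
qed

text \<open>The best approximation property. The residual \<open>r n\<close> is orthogonal to the
  first n Gram-Schmidt vectors, hence to the first n of the \<open>z k\<close>, hence to a given u
  in the span once n has passed the cut-off of u. So \<open>r n\<close> is no longer than v - u, for
  every later n.\<close>

lemma gram_schmidt_expansion:
  assumes z: "\<And>k. z k \<in> V" and v: "v \<in> V"
    and dense: "\<And>e. e > 0 \<Longrightarrow> \<exists>u\<in>lin_span z. B (\<lambda>x. v x - u x) (\<lambda>x. v x - u x) < e"
  defines "f \<equiv> gram_schmidt z"
  defines "r \<equiv> \<lambda>n x. v x - (\<Sum>j<n. (B v (f j) / B (f j) (f j)) * f j x)"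
  shows "(\<lambda>n. B (r n) (r n)) \<longlonglongrightarrow> 0"
proof (rule LIMSEQ_I)
  fix e :: real assume "e > 0"
  then obtain u where u: "u \<in> lin_span z" "B (\<lambda>x. v x - u x) (\<lambda>x. v x - u x) < e"
    using dense by blast
  obtain N where N: "\<forall>v\<in>V. (\<forall>k<N. B v (z k) = 0) \<longrightarrow> B v u = 0"
    using lin_span_orthogonal[OF u(1) z] by blast
  have f: "f k \<in> V" for k unfolding f_def using z by (rule gram_schmidt_closed)
  have uV: "u \<in> V" using u(1) z by (rule lin_span_closed)
  show "\<exists>N. \<forall>n\<ge>N. norm (B (r n) (r n) - 0) < e"
  proof (intro exI allI impI)
    fix n assume n: "n \<ge> N"
    let ?p = "\<lambda>x. \<Sum>j<n. (B v (f j) / B (f j) (f j)) * f j x"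
    have pV: "?p \<in> V" using f by (intro sum_closed) auto
    have rV: "r n \<in> V" unfolding r_def using v pV by (rule diff_closed)
    have rf: "B (r n) (f i) = 0" if "i < n" for i
      unfolding r_def by (rule project_orthogonal[OF f v that])
        (auto simp: f_def intro: gram_schmidt_orthogonal z)
    have "B (r n) (z k) = 0" if "k < n" for k
      by (rule orthogonal_gram_schmidt[OF z rV]) (use rf that in \<open>auto simp: f_def\<close>)
    then have ru: "B (r n) u = 0" using N n rV by auto
    have "B (r n) ?p = B ?p (r n)" using rV pV by (rule sym)
    also have "\<dots> = 0"
      using f rf rV by (subst sum_left) (auto intro!: sum.neutral simp: sym[of _ "r n"])
    finally have rp: "B (r n) ?p = 0" .
    let ?w = "\<lambda>x. ?p x - u x"
    have wV: "?w \<in> V" using pV uV by (rule diff_closed)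
    \<comment> \<open>Pythagoras: v - u is the residual plus ?p - u, and the residual is orthogonal
      to both ?p and u.\<close>
    have "(\<lambda>x. v x - u x) = (\<lambda>x. r n x + 1 * ?w x)" by (auto simp: r_def)
    then have "B (\<lambda>x. v x - u x) (\<lambda>x. v x - u x) = B (r n) (r n) + B ?w ?w"
      using form_lin[OF rV wV, of 1] ru rp rV pV uV by (simp add: diff_right)
    then show "norm (B (r n) (r n) - 0) < e"
      using u(2) nonneg[OF wV] nonneg[OF rV] by simp
  qed
qed

end

section \<open>Hahn and Jordan decomposition on the ring of bounded Borel sets\<close>

lemma bounded_borel_empty: "{} \<in> bounded_borel"
  by (simp add: bounded_borel_def)

lemma bounded_borel_Int: "A \<in> bounded_borel \<Longrightarrow> B \<in> sets borel \<Longrightarrow> A \<inter> B \<in> bounded_borel"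
  by (auto simp: bounded_borel_def intro: bounded_subset)

lemma bounded_borel_Diff: "A \<in> bounded_borel \<Longrightarrow> B \<in> sets borel \<Longrightarrow> A - B \<in> bounded_borel"
  by (auto simp: bounded_borel_def intro: bounded_subset)

lemma bounded_borel_subset: "A \<in> bounded_borel \<Longrightarrow> B \<in> sets borel \<Longrightarrow> B \<subseteq> A \<Longrightarrow> B \<in> bounded_borel"
  by (auto simp: bounded_borel_def intro: bounded_subset)

lemma bounded_borel_sets: "A \<in> bounded_borel \<Longrightarrow> A \<in> sets borel"
  by (simp add: bounded_borel_def)

lemma signed_measure_sums:
  fixes \<mu> :: "'a::euclidean_space set \<Rightarrow> real"
  assumes "signed_measure \<mu>" "\<And>n::nat. A n \<in> bounded_borel" "disjoint_family A" "(\<Union>n. A n) \<in> bounded_borel"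
  shows "(\<lambda>n. \<mu> (A n)) sums \<mu> (\<Union>n. A n)"
  using assms unfolding signed_measure_def by blast

lemma signed_measure_empty:
  assumes "signed_measure (\<mu> :: 'a::euclidean_space set \<Rightarrow> real)"
  shows "\<mu> {} = 0"
proof -
  have "(\<lambda>n::nat. \<mu> {}) sums \<mu> {}"
    using signed_measure_sums[OF assms, of "\<lambda>_. {}"] by (simp add: bounded_borel_empty disjoint_family_on_def)
  then have "summable (\<lambda>n::nat. \<mu> {})" by (rule sums_summable)
  then show ?thesis by (simp add: summable_const_iff)
qed

lemma signed_measure_Un:
  assumes "signed_measure (\<mu> :: 'a::euclidean_space set \<Rightarrow> real)"
    and AB: "A \<in> bounded_borel" "B \<in> bounded_borel" "A \<inter> B = {}"
  shows "\<mu> (A \<union> B) = \<mu> A + \<mu> B"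
proof -
  have "(\<lambda>n. \<mu> (binaryset A B n)) sums \<mu> (\<Union>n. binaryset A B n)"
  proof (rule signed_measure_sums[OF assms(1)])
    show "disjoint_family (binaryset A B)"
      using AB by (auto simp: disjoint_family_on_def binaryset_def)
    show "(\<Union>n. binaryset A B n) \<in> bounded_borel"
      using AB by (auto simp: UN_binaryset_eq bounded_borel_def)
  qed (use AB in \<open>auto simp: binaryset_def bounded_borel_empty\<close>)
  moreover have "(\<lambda>n. \<mu> (binaryset A B n)) sums (\<mu> A + \<mu> B)"
    using signed_measure_empty[OF assms(1)] by (rule binaryset_sums)
  ultimately show ?thesis by (simp add: UN_binaryset_eq sums_unique2)
qed

lemma signed_measure_split:
  assumes "signed_measure (\<mu> :: 'a::euclidean_space set \<Rightarrow> real)" "A \<in> bounded_borel" "B \<in> sets borel"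
  shows "\<mu> A = \<mu> (A \<inter> B) + \<mu> (A - B)"
  using signed_measure_Un[OF assms(1) bounded_borel_Int[OF assms(2,3)] bounded_borel_Diff[OF assms(2,3)]]
  by (simp add: Int_Diff_Un Int_Diff_disjoint)

lemma signed_measure_minus: "signed_measure \<mu> \<Longrightarrow> signed_measure (\<lambda>A. - \<mu> A)"
  unfolding signed_measure_def by (auto intro: sums_minus)

text \<open>Greedily remove sets of nearly extremal negative measure. The truncation at 1 makes the
  supremum finite although \<open>\<mu>\<close> is not yet known to be bounded.\<close>

lemma signed_measure_positive_subset:
  fixes \<mu> :: "'a::euclidean_space set \<Rightarrow> real"
  assumes \<mu>: "signed_measure \<mu>" and D: "D \<in> bounded_borel"
  obtains P where "P \<in> sets borel" "P \<subseteq> D" "\<mu> D \<le> \<mu> P"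
    "\<And>E. E \<in> sets borel \<Longrightarrow> E \<subseteq> P \<Longrightarrow> 0 \<le> \<mu> E"
proof -
  define g where "g E = min 1 (- \<mu> E)" for E
  \<comment> \<open>The supremum need not be attained, so a subset reaching half of it is chosen; if
    the supremum is not positive, the empty set qualifies.\<close>
  have "\<exists>E. E \<in> sets borel \<and> E \<subseteq> A \<and> 0 \<le> g E \<and> (\<forall>F\<in>sets borel. F \<subseteq> A \<longrightarrow> g F \<le> 2 * g E)"
    for A :: "'a set"
  proof -
    let ?S = "{E \<in> sets borel. E \<subseteq> A}"
    have g0: "g {} = 0" using signed_measure_empty[OF \<mu>] by (simp add: g_def)
    have bdd: "bdd_above (g ` ?S)" by (rule bdd_aboveI[of _ 1]) (auto simp: g_def)
    have up: "g F \<le> Sup (g ` ?S)" if "F \<in> ?S" for F using that bdd by (intro cSup_upper imageI)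
    show ?thesis
    proof (cases "Sup (g ` ?S) > 0")
      case True
      then have "\<exists>y\<in>g ` ?S. Sup (g ` ?S) / 2 < y" by (intro less_cSupD) auto
      then obtain E where "E \<in> ?S" "Sup (g ` ?S) / 2 < g E" by blast
      then show ?thesis using up True by (intro exI[of _ E]) fastforce
    next
      case False
      then show ?thesis using up g0 by (intro exI[of _ "{}"]) fastforce
    qed
  qed
  then obtain ch where ch: "\<And>A. ch A \<in> sets borel" "\<And>A. ch A \<subseteq> A" "\<And>A. 0 \<le> g (ch A)"
    "\<And>A F. F \<in> sets borel \<Longrightarrow> F \<subseteq> A \<Longrightarrow> g F \<le> 2 * g (ch A)"
    by metis
  define A where "A = rec_nat D (\<lambda>_ A. A - ch A)"
  have A0: "A 0 = D" and ASuc: "A (Suc n) = A n - ch (A n)" for n by (simp_all add: A_def)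
  have Abb: "A n \<in> bounded_borel" for n
    by (induction n) (auto simp: A0 ASuc D intro: bounded_borel_Diff ch)
  have dec: "decseq A" by (rule decseq_SucI) (auto simp: ASuc)
  define E where "E n = ch (A n)" for n
  have EA: "E n \<subseteq> A n" for n by (simp add: E_def ch)
  have disj: "E m \<inter> E n = {}" if "m < n" for m n
  proof -
    have "A n \<subseteq> A (Suc m)" using dec that by (simp add: decseqD)
    then show ?thesis using EA[of n] by (auto simp: ASuc E_def)
  qed
  have Ebb: "E n \<in> bounded_borel" for n
    using bounded_borel_subset[OF Abb _ EA[of n]] by (simp add: E_def ch)
  have UD: "(\<Union>n. E n) \<subseteq> D" using EA dec A0 by (metis UN_least decseqD le0 order_trans)
  have Ubb: "(\<Union>n. E n) \<in> bounded_borel"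
    by (rule bounded_borel_subset[OF D _ UD]) (use Ebb in \<open>auto intro: bounded_borel_sets\<close>)
  have sums: "(\<lambda>n. \<mu> (E n)) sums \<mu> (\<Union>n. E n)"
    by (rule signed_measure_sums[OF \<mu> Ebb _ Ubb])
      (metis disj disjoint_family_on_def inf_commute linorder_neqE_nat)
  have neg: "\<mu> (E n) \<le> 0" for n using ch(3)[of "A n"] by (simp add: g_def E_def)
  \<comment> \<open>The terms of a convergent series tend to 0. A subset F of what remains lies in
    every \<open>A n\<close>, so g F is at most twice each of these null terms, hence not
    positive.\<close>
  have lim: "(\<lambda>n. 2 * - \<mu> (E n)) \<longlonglongrightarrow> 0"
    using tendsto_mult[OF tendsto_const[of 2] tendsto_minus[OF summable_LIMSEQ_zero[OF sums_summable[OF sums]]]]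
    by simp
  let ?P = "D - (\<Union>n. E n)"
  have PA: "?P \<subseteq> A n" for n by (induction n) (auto simp: A0 ASuc E_def)
  show thesis
  proof
    show "?P \<in> sets borel" using bounded_borel_sets[OF D] bounded_borel_sets[OF Ubb] by blast
    have "\<mu> D = \<mu> (D \<inter> (\<Union>n. E n)) + \<mu> ?P"
      by (rule signed_measure_split[OF \<mu> D bounded_borel_sets[OF Ubb]])
    moreover have "D \<inter> (\<Union>n. E n) = (\<Union>n. E n)" using UD by blast
    moreover have "\<mu> (\<Union>n. E n) \<le> 0" by (rule sums_le[OF _ sums sums_zero]) (rule neg)
    ultimately show "\<mu> D \<le> \<mu> ?P" by simp
    fix F assume F: "F \<in> sets borel" "F \<subseteq> ?P"
    have "g F \<le> 2 * - \<mu> (E n)" for n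
    proof -
      have "g F \<le> 2 * g (E n)" using F PA[of n] unfolding E_def by (intro ch) auto
      also have "\<dots> \<le> 2 * - \<mu> (E n)" by (simp add: g_def)
      finally show ?thesis .
    qed
    then have "g F \<le> 0" using lim by (intro LIMSEQ_le_const) auto
    then show "0 \<le> \<mu> F" by (auto simp: g_def min_def split: if_splits)
  qed auto
qed

text \<open>Exhaustion: P is a countable union of positive sets whose measures approach the supremum
  over all positive subsets of B. If some set outside P had positive measure,
  \<open>signed_measure_positive_subset\<close> would give a positive set inside it, and adjoining
  that to P would exceed the supremum.\<close>

lemma signed_measure_hahn:
  fixes \<mu> :: "'a::euclidean_space set \<Rightarrow> real"
  assumes \<mu>: "signed_measure \<mu>" and B: "B \<in> bounded_borel"
  obtains P where "P \<in> sets borel" "P \<subseteq> B"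
    "\<And>E. E \<in> sets borel \<Longrightarrow> E \<subseteq> P \<Longrightarrow> 0 \<le> \<mu> E"
    "\<And>E. E \<in> sets borel \<Longrightarrow> E \<subseteq> B - P \<Longrightarrow> \<mu> E \<le> 0"
proof -
  define Pos where "Pos = {Q \<in> sets borel. Q \<subseteq> B \<and> (\<forall>E\<in>sets borel. E \<subseteq> Q \<longrightarrow> 0 \<le> \<mu> E)}"
  have "{} \<in> Pos" using signed_measure_empty[OF \<mu>] by (auto simp: Pos_def)
  then have "Pos \<noteq> {}" by blast
  \<comment> \<open>The supremum is taken in \<open>ennreal\<close> so that it exists before \<mu>
    is known to be bounded on subsets of B; its finiteness comes out of \<open>max\<close>.\<close>
  then obtain v :: "nat \<Rightarrow> ennreal" where v: "range v \<subseteq> (\<lambda>Q. ennreal (\<mu> Q)) ` Pos"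
    "(SUP Q\<in>Pos. ennreal (\<mu> Q)) = Sup (range v)"
    using ennreal_SUP_countable_SUP[of Pos "\<lambda>Q. ennreal (\<mu> Q)"] by meson
  have "\<forall>n::nat. \<exists>Q\<in>Pos. v n = ennreal (\<mu> Q)" using v(1) by blast
  then obtain Q where Q: "\<And>n::nat. Q n \<in> Pos" "\<And>n. v n = ennreal (\<mu> (Q n))" by metis
  define P where "P = (\<Union>n. Q n)"
  have P: "P \<in> sets borel" "P \<subseteq> B" using Q unfolding P_def Pos_def by auto
  have Pbb: "P \<in> bounded_borel" using bounded_borel_subset[OF B P] .
  have pos: "0 \<le> \<mu> E" if E: "E \<in> sets borel" "E \<subseteq> P" for E
  proof -
    have d: "disjointed Q n \<in> sets borel" for n
      using sets.range_disjointed_sets[of Q borel] Q by (auto simp: Pos_def)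
    have un: "(\<Union>n. E \<inter> disjointed Q n) = E"
      using E(2) UN_disjointed_eq[of Q] by (auto simp: P_def)
    have bb: "E \<inter> disjointed Q n \<in> bounded_borel" for n
      using bounded_borel_Int[OF bounded_borel_subset[OF Pbb E] d] .
    have "(\<lambda>n. \<mu> (E \<inter> disjointed Q n)) sums \<mu> (\<Union>n. E \<inter> disjointed Q n)"
    proof (rule signed_measure_sums[OF \<mu> bb])
      show "disjoint_family (\<lambda>n. E \<inter> disjointed Q n)"
        using disjoint_family_disjointed[of Q] by (auto simp: disjoint_family_on_def)
    qed (use un bounded_borel_subset[OF Pbb E] in simp)
    moreover have "0 \<le> \<mu> (E \<inter> disjointed Q n)" for n
      using Q(1)[of n] disjointed_subset[of Q n] bounded_borel_sets[OF bb[of n]] by (auto simp: Pos_def)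
    ultimately show ?thesis using sums_le[of "\<lambda>_. 0", OF _ sums_zero] un by metis
  qed
  have max: "\<mu> R \<le> \<mu> P" if "R \<in> Pos" for R
  proof -
    have "ennreal (\<mu> R) \<le> Sup (range v)" using that v(2) by (metis SUP_upper)
    also have "\<dots> \<le> ennreal (\<mu> P)"
    proof (rule SUP_least)
      fix n
      have "\<mu> P = \<mu> (P \<inter> Q n) + \<mu> (P - Q n)"
        using Q(1) by (intro signed_measure_split[OF \<mu> Pbb]) (auto simp: Pos_def)
      moreover have "P \<inter> Q n = Q n" by (auto simp: P_def)
      moreover have "0 \<le> \<mu> (P - Q n)" using P Q(1)[of n] by (intro pos) (auto simp: Pos_def)
      ultimately show "v n \<le> ennreal (\<mu> P)" by (simp add: Q ennreal_leI)
    qed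
    finally show ?thesis using pos[OF P(1)] by (simp add: ennreal_le_iff)
  qed
  show thesis
  proof
    fix E assume E: "E \<in> sets borel" "E \<subseteq> B - P"
    show "\<mu> E \<le> 0"
    proof (rule ccontr)
      assume "\<not> \<mu> E \<le> 0"
      have Ebb: "E \<in> bounded_borel" using E B by (auto intro: bounded_borel_subset)
      obtain R where R: "R \<in> sets borel" "R \<subseteq> E" "\<mu> E \<le> \<mu> R"
        "\<And>F. F \<in> sets borel \<Longrightarrow> F \<subseteq> R \<Longrightarrow> 0 \<le> \<mu> F"
        using signed_measure_positive_subset[OF \<mu> Ebb] by blast
      have Rbb: "R \<in> bounded_borel" using bounded_borel_subset[OF Ebb R(1,2)] .
      have "0 \<le> \<mu> F" if F: "F \<in> sets borel" "F \<subseteq> P \<union> R" for F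
      proof -
        have Fbb: "F \<in> bounded_borel"
          using F P(2) R(2) E(2) by (intro bounded_borel_subset[OF B]) blast+
        have "\<mu> F = \<mu> (F \<inter> P) + \<mu> (F - P)" by (rule signed_measure_split[OF \<mu> Fbb P(1)])
        moreover have "0 \<le> \<mu> (F \<inter> P)" using F P by (intro pos) auto
        moreover have "0 \<le> \<mu> (F - P)" using F P by (intro R(4)) auto
        ultimately show ?thesis by simp
      qed
      then have "P \<union> R \<in> Pos" using P R E by (auto simp: Pos_def)
      from max[OF this] have "\<mu> (P \<union> R) \<le> \<mu> P" .
      moreover have "\<mu> (P \<union> R) = \<mu> P + \<mu> R"
        using R E by (intro signed_measure_Un[OF \<mu> Pbb Rbb]) auto
      ultimately show False using R \<open>\<not> \<mu> E \<le> 0\<close> by simp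
    qed
  qed (use P pos in auto)
qed

text \<open>Hahn's theorem is available on bounded sets only, so it is applied on each annulus of a
  partition of the space, and the positive parts are united to H. The resulting total variation w on
  bounded sets is extended to all Borel sets by summing over the annuli.\<close>

lemma signed_measure_jordan:
  fixes \<mu> :: "'a::euclidean_space set \<Rightarrow> real"
  assumes \<mu>: "signed_measure \<mu>"
  obtains T H where "positive_measure T" "H \<in> sets borel"
    "\<And>A. A \<in> bounded_borel \<Longrightarrow> emeasure T (A \<inter> H) = ennreal (\<mu> (A \<inter> H)) \<and> 0 \<le> \<mu> (A \<inter> H)"
    "\<And>A. A \<in> bounded_borel \<Longrightarrow> emeasure T (A - H) = ennreal (- \<mu> (A - H)) \<and> \<mu> (A - H) \<le> 0"
proof -
  \<comment> \<open>Half-open annuli: bounded, pairwise disjoint and covering the space.\<close>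
  define B where "B n = {x::'a. real n \<le> norm x \<and> norm x < real (Suc n)}" for n
  have Bbb: "B n \<in> bounded_borel" for n
  proof -
    have "B n \<in> sets borel" unfolding B_def by measurable
    moreover have "bounded (B n)" unfolding bounded_iff
      by (rule exI[of _ "real (Suc n)"]) (simp add: B_def)
    ultimately show ?thesis by (simp add: bounded_borel_def)
  qed
  have Bdisj: "disjoint_family B"
  proof -
    have "B m \<inter> B n = {}" if "m < n" for m n
      using that of_nat_mono[of "Suc m" n, where 'a=real] by (auto simp: B_def)
    then show ?thesis by (metis disjoint_family_on_def inf_commute linorder_neqE_nat)
  qed
  have BU: "\<exists>n. x \<in> B n" for x
    unfolding B_def using floor_correct[of "norm x"]
    by (intro exI[of _ "nat \<lfloor>norm x\<rfloor>"]) (auto, linarith)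
  have "\<exists>P. P \<in> sets borel \<and> P \<subseteq> B n \<and> (\<forall>E\<in>sets borel. E \<subseteq> P \<longrightarrow> 0 \<le> \<mu> E) \<and>
      (\<forall>E\<in>sets borel. E \<subseteq> B n - P \<longrightarrow> \<mu> E \<le> 0)" for n
    by (rule signed_measure_hahn[OF \<mu> Bbb[of n]]) blast
  then obtain P where P: "\<And>n. P n \<in> sets borel" "\<And>n. P n \<subseteq> B n"
    "\<And>n E. E \<in> sets borel \<Longrightarrow> E \<subseteq> P n \<Longrightarrow> 0 \<le> \<mu> E"
    "\<And>n E. E \<in> sets borel \<Longrightarrow> E \<subseteq> B n - P n \<Longrightarrow> \<mu> E \<le> 0"
    by metis
  define H where "H = (\<Union>n. P n)"
  have H: "H \<in> sets borel" using P(1) by (auto simp: H_def)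
  have BH: "E \<inter> H \<subseteq> P n" "E - H \<subseteq> B n - P n" if "E \<subseteq> B n" for E n
  proof -
    have *: "m = n" if "x \<in> B m" "x \<in> B n" for x m
      using that Bdisj by (auto simp: disjoint_family_on_def)
    show "E \<inter> H \<subseteq> P n"
    proof
      fix x assume x: "x \<in> E \<inter> H"
      then obtain m where "x \<in> P m" by (auto simp: H_def)
      then show "x \<in> P n" using *[of x m] P(2) that x by blast
    qed
    show "E - H \<subseteq> B n - P n" using that by (auto simp: H_def)
  qed
  define w where "w E = \<mu> (E \<inter> H) - \<mu> (E - H)" for E
  have w: "signed_measure w"
    unfolding signed_measure_def
  proof safe
    fix A :: "nat \<Rightarrow> 'a set"
    assume A: "range A \<subseteq> bounded_borel" "disjoint_family A" "(\<Union>n. A n) \<in> bounded_borel"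
    have Abb: "A n \<in> bounded_borel" for n using A(1) by auto
    have "(\<lambda>n. \<mu> (A n \<inter> H)) sums \<mu> (\<Union>n. A n \<inter> H)"
      using A bounded_borel_Int[OF A(3) H]
      by (intro signed_measure_sums[OF \<mu>]) (auto simp: bounded_borel_Int[OF Abb H] disjoint_family_on_def)
    moreover have "(\<lambda>n. \<mu> (A n - H)) sums \<mu> (\<Union>n. A n - H)"
      using A bounded_borel_Diff[OF A(3) H]
      by (intro signed_measure_sums[OF \<mu>]) (auto simp: bounded_borel_Diff[OF Abb H] disjoint_family_on_def)
    ultimately show "(\<lambda>n. w (A n)) sums w (\<Union>n. A n)"
      unfolding w_def by (auto intro!: sums_diff)
  qed
  have w_pos: "0 \<le> w (A \<inter> B n)" if "A \<in> sets borel" for A n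
  proof -
    have "0 \<le> \<mu> (A \<inter> B n \<inter> H)" using that H Bbb[of n] BH[of "A \<inter> B n" n]
      by (intro P(3)[of _ n]) (auto dest: bounded_borel_sets)
    moreover have "\<mu> (A \<inter> B n - H) \<le> 0" using that H Bbb[of n] BH[of "A \<inter> B n" n]
      by (intro P(4)[of _ n]) (auto dest: bounded_borel_sets)
    ultimately show ?thesis by (simp add: w_def)
  qed
  define f where "f A = (\<Sum>n. ennreal (w (A \<inter> B n)))" for A
  define T where "T = measure_of UNIV (sets borel) f"
  have setsT: "sets T = sets borel"
    unfolding T_def using sets.sigma_algebra_axioms[of borel]
    by (metis sets.sigma_sets_eq sets_measure_of space_borel subset_UNIV Pow_UNIV)
  have emT: "emeasure T A = f A" if A: "A \<in> sets borel" for A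
    unfolding T_def
  proof (rule emeasure_measure_of_sigma)
    show "sigma_algebra UNIV (sets (borel :: 'a measure))"
      using sets.sigma_algebra_axioms[of "borel :: 'a measure"] by simp
    show "positive (sets borel) f"
      using signed_measure_empty[OF w] by (simp add: positive_def f_def)
    show "countably_additive (sets borel) f"
    proof (rule countably_additiveI)
      fix A :: "nat \<Rightarrow> 'a set"
      assume A: "range A \<subseteq> sets borel" "disjoint_family A"
      \<comment> \<open>The two sums of nonnegative terms are interchanged by reading the outer one
        as an integral over counting measure.\<close>
      have "(\<Sum>i. f (A i)) = (\<integral>\<^sup>+i. (\<Sum>n. ennreal (w (A i \<inter> B n))) \<partial>count_space UNIV)"
        by (simp add: f_def nn_integral_count_space_nat)
      also have "\<dots> = (\<Sum>n. \<integral>\<^sup>+i. ennreal (w (A i \<inter> B n)) \<partial>count_space UNIV)"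
        by (rule nn_integral_suminf) auto
      also have "\<dots> = (\<Sum>n. ennreal (w ((\<Union>i. A i) \<inter> B n)))"
      proof (rule suminf_cong)
        fix n
        have *: "A i \<inter> B n \<in> bounded_borel" for i
          using bounded_borel_Int[OF Bbb[of n], of "A i"] A(1) by (auto simp: Int_commute)
        have "(\<lambda>i. w (A i \<inter> B n)) sums w (\<Union>i. A i \<inter> B n)"
        proof (rule signed_measure_sums[OF w *])
          show "(\<Union>i. A i \<inter> B n) \<in> bounded_borel"
            using bounded_borel_sets[OF *] by (intro bounded_borel_subset[OF Bbb[of n]] sets.countable_UN) auto
        qed (use A(2) in \<open>auto simp: disjoint_family_on_def\<close>)
        then have "(\<Sum>i. ennreal (w (A i \<inter> B n))) = ennreal (w (\<Union>i. A i \<inter> B n))"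
          using A(1) by (intro suminf_ennreal_eq w_pos) auto
        then show "(\<integral>\<^sup>+i. ennreal (w (A i \<inter> B n)) \<partial>count_space UNIV) = ennreal (w ((\<Union>i. A i) \<inter> B n))"
          by (simp add: nn_integral_count_space_nat)
      qed
      also have "\<dots> = f (\<Union>i. A i)" by (simp add: f_def)
      finally show "(\<Sum>i. f (A i)) = f (\<Union>i. A i)" .
    qed
  qed fact
  have wT: "emeasure T A = ennreal (w A) \<and> 0 \<le> w A" if A: "A \<in> bounded_borel" for A
  proof -
    have un: "(\<Union>n. A \<inter> B n) = A" using BU by blast
    have "(\<lambda>n. w (A \<inter> B n)) sums w (\<Union>n. A \<inter> B n)"
      using A un Bdisj
      by (intro signed_measure_sums[OF w]) (auto intro!: bounded_borel_Int bounded_borel_sets[OF Bbb] simp: disjoint_family_on_def)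
    then have s: "(\<lambda>n. w (A \<inter> B n)) sums w A" by (simp only: un)
    have "f A = ennreal (w A)" unfolding f_def
      using A s by (intro suminf_ennreal_eq w_pos) (auto dest: bounded_borel_sets)
    moreover have "0 \<le> w A" by (rule sums_le[OF _ sums_zero s]) (rule w_pos[OF bounded_borel_sets[OF A]])
    ultimately show ?thesis using A by (simp add: emT bounded_borel_sets)
  qed
  show thesis
  proof (rule that[OF _ H])
    show "positive_measure T" using wT by (simp add: positive_measure_def setsT)
    fix A :: "'a set" assume A: "A \<in> bounded_borel"
    show "emeasure T (A \<inter> H) = ennreal (\<mu> (A \<inter> H)) \<and> 0 \<le> \<mu> (A \<inter> H)"
      using wT[OF bounded_borel_Int[OF A H]] signed_measure_empty[OF \<mu>]
      by (simp add: w_def Int_assoc Diff_eq)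
    have "(A - H) \<inter> H = {}" "A - H - H = A - H" by auto
    then show "emeasure T (A - H) = ennreal (- \<mu> (A - H)) \<and> \<mu> (A - H) \<le> 0"
      using wT[OF bounded_borel_Diff[OF A H]] signed_measure_empty[OF \<mu>]
      by (simp add: w_def)
  qed
qed

section \<open>Exhaustion by balls and the comparison of Borel measures on bounded sets\<close>

lemma bounded_borel_Int_ball: "A \<in> sets borel \<Longrightarrow> A \<inter> ball 0 r \<in> bounded_borel"
  by (auto simp: bounded_borel_def intro: bounded_subset)

lemma UN_Int_ball: "(\<Union>n. A \<inter> ball 0 (real n)) = A"
  for A :: "'a::euclidean_space set"
proof -
  have "\<exists>n. x \<in> ball 0 (real n)" for x :: 'a
    using reals_Archimedean2[of "norm x"] by simp
  then show ?thesis by blast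
qed

lemma indicator_Int_ball_tendsto:
  fixes A :: "'a::euclidean_space set"
  shows "(\<lambda>n. indicator (A \<inter> ball 0 (real n)) x) \<longlonglongrightarrow> (indicator A x :: real)"
proof (rule tendsto_eventually)
  have "eventually (\<lambda>n. real n > norm x) sequentially"
    using filterlim_at_top_dense[of real sequentially] filterlim_real_sequentially by blast
  then show "eventually (\<lambda>n. indicator (A \<inter> ball 0 (real n)) x = (indicator A x :: real)) sequentially"
    by eventually_elim (auto simp: indicator_def)
qed

lemma emeasure_SUP_ball:
  fixes M :: "'a::euclidean_space measure"
  assumes M: "sets M = sets borel" and A: "A \<in> sets borel"
  shows "(SUP n. emeasure M (A \<inter> ball 0 (real n))) = emeasure M A"
proof -
  have "(SUP n. emeasure M (A \<inter> ball 0 (real n))) = emeasure M (\<Union>n. A \<inter> ball 0 (real n))"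
  proof (rule SUP_emeasure_incseq)
    show "incseq (\<lambda>n. A \<inter> ball 0 (real n))" by (auto simp: incseq_def)
    show "range (\<lambda>n. A \<inter> ball 0 (real n)) \<subseteq> sets M"
      unfolding M by (intro image_subsetI sets.Int A) simp
  qed
  then show ?thesis by (simp only: UN_Int_ball)
qed

text \<open>Continuity from below along balls. It bridges the order behind \<open>LEAST\<close>,
  which concerns all Borel sets, and the defining inequalities, which concern bounded ones.\<close>

lemma measure_le_if_bounded:
  fixes M N :: "'a::euclidean_space measure"
  assumes M: "sets M = sets borel" and N: "sets N = sets borel"
    and le: "\<And>A. A \<in> bounded_borel \<Longrightarrow> emeasure M A \<le> emeasure N A"
  shows "M \<le> N"
proof -
  have "emeasure M A \<le> emeasure N A" if A: "A \<in> sets borel" for A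
    unfolding emeasure_SUP_ball[OF M A, symmetric] emeasure_SUP_ball[OF N A, symmetric]
    by (intro SUP_mono' le bounded_borel_Int_ball A)
  then show ?thesis using M N by (subst le_measure) auto
qed

lemma emeasure_split:
  assumes "A \<in> sets M" "B \<in> sets M"
  shows "emeasure M A = emeasure M (A \<inter> B) + emeasure M (A - B)"
  using plus_emeasure[of "A \<inter> B" M "A - B"] assms by (simp add: Int_Diff_Un Int_Diff_disjoint)

text \<open>Minimality holds because a competitor N can be tested on A \<inter> H and A - H
  separately, where \<bar>\<mu>\<bar> already equals T. For the positive part only A \<inter> H
  contributes.\<close>

lemma jordan_variation:
  fixes \<mu> :: "'a::euclidean_space set \<Rightarrow> real"
  assumes \<mu>: "signed_measure \<mu>" and T: "positive_measure T" and H: "H \<in> sets borel"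
    and pos: "\<And>A. A \<in> bounded_borel \<Longrightarrow> emeasure T (A \<inter> H) = ennreal (\<mu> (A \<inter> H)) \<and> 0 \<le> \<mu> (A \<inter> H)"
    and neg: "\<And>A. A \<in> bounded_borel \<Longrightarrow> emeasure T (A - H) = ennreal (- \<mu> (A - H)) \<and> \<mu> (A - H) \<le> 0"
  shows "total_variation \<mu> = T" and "positive_variation \<mu> = density T (indicator H)"
proof -
  have sT[simp]: "sets T = sets borel" using T by (simp add: positive_measure_def)
  have sp: "\<mu> A = \<mu> (A \<inter> H) + \<mu> (A - H)" if "A \<in> bounded_borel" for A
    using \<mu> that H by (rule signed_measure_split)
  show "total_variation \<mu> = T" unfolding total_variation_def
  proof (rule Least_equality)
    have "ennreal \<bar>\<mu> A\<bar> \<le> emeasure T A" if A: "A \<in> bounded_borel" for A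
    proof -
      have "ennreal \<bar>\<mu> A\<bar> \<le> ennreal (\<mu> (A \<inter> H) + - \<mu> (A - H))"
        using sp[OF A] pos[OF A] neg[OF A] by (intro ennreal_leI) auto
      also have "\<dots> = emeasure T A"
        using pos[OF A] neg[OF A] emeasure_split[of A T H] A H
        by (subst ennreal_plus) (auto dest: bounded_borel_sets)
      finally show ?thesis .
    qed
    then show "positive_measure T \<and> (\<forall>A\<in>bounded_borel. ennreal \<bar>\<mu> A\<bar> \<le> emeasure T A)"
      using T by blast
  next
    fix N assume N: "positive_measure N \<and> (\<forall>A\<in>bounded_borel. ennreal \<bar>\<mu> A\<bar> \<le> emeasure N A)"
    then have sN: "sets N = sets borel" by (simp add: positive_measure_def)
    show "T \<le> N"
    proof (rule measure_le_if_bounded[OF sT sN])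
      fix A :: "'a set" assume A: "A \<in> bounded_borel"
      have "emeasure T A = ennreal \<bar>\<mu> (A \<inter> H)\<bar> + ennreal \<bar>\<mu> (A - H)\<bar>"
        using pos[OF A] neg[OF A] emeasure_split[of A T H] A H by (auto dest: bounded_borel_sets)
      also have "\<dots> \<le> emeasure N (A \<inter> H) + emeasure N (A - H)"
        using N bounded_borel_Int[OF A H] bounded_borel_Diff[OF A H] by (intro add_mono) auto
      also have "\<dots> = emeasure N A"
        using A H sN by (intro emeasure_split[symmetric]) (auto dest: bounded_borel_sets)
      finally show "emeasure T A \<le> emeasure N A" .
    qed
  qed
  have em: "emeasure (density T (indicator H)) A = emeasure T (A \<inter> H)" if "A \<in> sets borel" for A
    using that H by (subst emeasure_restricted) (auto simp: Int_commute)
  show "positive_variation \<mu> = density T (indicator H)" unfolding positive_variation_def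
  proof (rule Least_equality)
    have "ennreal (\<mu> A) \<le> emeasure T (A \<inter> H)" if A: "A \<in> bounded_borel" for A
      using sp[OF A] pos[OF A] neg[OF A] by (auto intro!: ennreal_leI)
    moreover have "emeasure T (A \<inter> H) < \<infinity>" if A: "A \<in> bounded_borel" for A
      using T bounded_borel_Int[OF A H] by (auto simp: positive_measure_def)
    ultimately show "positive_measure (density T (indicator H)) \<and>
        (\<forall>A\<in>bounded_borel. ennreal (\<mu> A) \<le> emeasure (density T (indicator H)) A)"
      by (auto simp: positive_measure_def em bounded_borel_sets)
  next
    fix N assume N: "positive_measure N \<and> (\<forall>A\<in>bounded_borel. ennreal (\<mu> A) \<le> emeasure N A)"
    then have sN: "sets N = sets borel" by (simp add: positive_measure_def)
    show "density T (indicator H) \<le> N"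
    proof (rule measure_le_if_bounded[OF _ sN])
      fix A :: "'a set" assume A: "A \<in> bounded_borel"
      have "emeasure T (A \<inter> H) \<le> emeasure N (A \<inter> H)"
        using pos[OF A] N bounded_borel_Int[OF A H] by auto
      also have "\<dots> \<le> emeasure N A" using A sN by (intro emeasure_mono) (auto dest: bounded_borel_sets)
      finally show "emeasure (density T (indicator H)) A \<le> emeasure N A"
        using A by (simp add: em bounded_borel_sets)
    qed simp
  qed
qed

lemma jordan_decomposition:
  fixes \<mu> :: "'a::euclidean_space set \<Rightarrow> real"
  assumes \<mu>: "signed_measure \<mu>"
  obtains H where "positive_measure (total_variation \<mu>)" "H \<in> sets borel"
    "\<And>A. A \<in> bounded_borel \<Longrightarrow> emeasure (total_variation \<mu>) A = ennreal (\<mu> (A \<inter> H) - \<mu> (A - H))"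
    "\<And>A. A \<in> bounded_borel \<Longrightarrow>
      \<mu> A = measure (total_variation \<mu>) (A \<inter> H) - measure (total_variation \<mu>) (A - H)"
    "positive_variation \<mu> = density (total_variation \<mu>) (indicator H)"
    "positive_variation (\<lambda>A. - \<mu> A) = density (total_variation \<mu>) (indicator (- H))"
proof -
  obtain T H where T: "positive_measure T" "H \<in> sets borel"
    and pos: "\<And>A. A \<in> bounded_borel \<Longrightarrow> emeasure T (A \<inter> H) = ennreal (\<mu> (A \<inter> H)) \<and> 0 \<le> \<mu> (A \<inter> H)"
    and neg: "\<And>A. A \<in> bounded_borel \<Longrightarrow> emeasure T (A - H) = ennreal (- \<mu> (A - H)) \<and> \<mu> (A - H) \<le> 0"
    by (rule signed_measure_jordan[OF \<mu>]) (rule that)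
  have tv: "total_variation \<mu> = T" "positive_variation \<mu> = density T (indicator H)"
    by (intro jordan_variation[OF \<mu> T] pos neg; assumption)+
  have sT: "sets T = sets borel" using T by (simp add: positive_measure_def)
  \<comment> \<open>For - \<mu> the roles of H and its complement are exchanged.\<close>
  have c: "positive_variation (\<lambda>A. - \<mu> A) = density T (indicator (- H))"
  proof (rule jordan_variation(2)[OF signed_measure_minus[OF \<mu>] T(1)])
    fix A :: "'a set" assume A: "A \<in> bounded_borel"
    have "A \<inter> - H = A - H" "A - - H = A \<inter> H" by auto
    note * = this
    show "emeasure T (A \<inter> - H) = ennreal (- \<mu> (A \<inter> - H)) \<and> 0 \<le> - \<mu> (A \<inter> - H)"
      unfolding * using neg[OF A] by simp
    show "emeasure T (A - - H) = ennreal (- (- \<mu> (A - - H))) \<and> - \<mu> (A - - H) \<le> 0"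
      unfolding * using pos[OF A] by simp
  qed (use T(2) in auto)
  show thesis
  proof (rule that[OF _ T(2)], unfold tv(1))
    fix A :: "'a set" assume A: "A \<in> bounded_borel"
    show "emeasure T A = ennreal (\<mu> (A \<inter> H) - \<mu> (A - H))"
      using pos[OF A] neg[OF A] emeasure_split[of A T H] A T(2) sT
      by (subst diff_conv_add_uminus, subst ennreal_plus) (auto dest: bounded_borel_sets)
    show "\<mu> A = measure T (A \<inter> H) - measure T (A - H)"
      using pos[OF A] neg[OF A] signed_measure_split[OF \<mu> A T(2)] by (simp add: measure_def)
  qed (simp_all only: T(1) tv(2) c)
qed

section \<open>Bounded Borel functions and their induction principle\<close>

definition bounded_measurable :: "('a::topological_space \<Rightarrow> real) set" where
  "bounded_measurable = {f \<in> borel_measurable borel. bounded (range f)}"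

lemma bounded_measurableI:
  "f \<in> borel_measurable borel \<Longrightarrow> (\<And>x. \<bar>f x\<bar> \<le> K) \<Longrightarrow> f \<in> bounded_measurable"
  by (auto simp: bounded_measurable_def bounded_iff)

lemma bounded_measurable_measurable [measurable_dest]:
  "f \<in> bounded_measurable \<Longrightarrow> f \<in> borel_measurable borel"
  by (simp add: bounded_measurable_def)

lemma bounded_measurable_bound:
  assumes "f \<in> bounded_measurable"
  obtains K where "K \<ge> 0" "\<And>x. \<bar>f x\<bar> \<le> K"
proof -
  obtain K where "\<And>x. \<bar>f x\<bar> \<le> K" using assms by (auto simp: bounded_measurable_def bounded_iff)
  then show thesis using that[of "max 0 K"] by (simp add: le_max_iff_disj)
qed

lemma bounded_measurable_indicator: "A \<in> sets borel \<Longrightarrow> indicator A \<in> bounded_measurable"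
  by (rule bounded_measurableI[of _ 1]) (auto simp: indicator_def)

lemma bounded_measurable_lin:
  assumes "f \<in> bounded_measurable" "g \<in> bounded_measurable"
  shows "(\<lambda>x. f x + c * g x) \<in> bounded_measurable"
proof -
  obtain K L where KL: "\<And>x. \<bar>f x\<bar> \<le> K" "\<And>x. \<bar>g x\<bar> \<le> L"
    using bounded_measurable_bound[OF assms(1)] bounded_measurable_bound[OF assms(2)] by metis
  have "\<bar>f x + c * g x\<bar> \<le> K + \<bar>c\<bar> * L" for x
    using abs_triangle_ineq[of "f x" "c * g x"] KL(1)[of x] mult_left_mono[OF KL(2)[of x], of "\<bar>c\<bar>"]
    by (simp add: abs_mult)
  moreover note [measurable] = assms[THEN bounded_measurable_measurable]
  have "(\<lambda>x. f x + c * g x) \<in> borel_measurable borel" by measurable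
  ultimately show ?thesis by (intro bounded_measurableI)
qed

lemma bounded_measurable_zero: "(\<lambda>_. 0) \<in> bounded_measurable"
  by (rule bounded_measurableI[of _ 0]) auto

text \<open>Any bounded Borel function is a limit of simple functions under one common bound.
  Keeping that bound K in the limit case is what lets dominated convergence over finite measures
  discharge it.\<close>

lemma bounded_measurable_induct [consumes 1, case_names indicator lin lim]:
  assumes f: "f \<in> bounded_measurable"
    and ind: "\<And>A. A \<in> sets borel \<Longrightarrow> P (indicator A)"
    and lin: "\<And>f g c. f \<in> bounded_measurable \<Longrightarrow> g \<in> bounded_measurable \<Longrightarrow> P f \<Longrightarrow> P g \<Longrightarrow>
      P (\<lambda>x. f x + c * g x)"
    and lim: "\<And>F f K. (\<And>n::nat. F n \<in> bounded_measurable) \<Longrightarrow> (\<And>n. P (F n)) \<Longrightarrow>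
      (\<And>n x. \<bar>F n x\<bar> \<le> K) \<Longrightarrow> (\<And>x. (\<lambda>n. F n x) \<longlonglongrightarrow> f x) \<Longrightarrow> P f"
  shows "P f"
proof -
  obtain K where K: "\<And>x. \<bar>f x\<bar> \<le> K" using bounded_measurable_bound[OF f] by metis
  have simple: "s \<in> bounded_measurable \<and> P s" if s: "simple_function borel s" for s :: "'a \<Rightarrow> real"
  proof -
    have "(\<lambda>x. \<Sum>y\<in>Y. y * indicator (s -` {y}) x) \<in> bounded_measurable \<and>
        P (\<lambda>x. \<Sum>y\<in>Y. y * indicator (s -` {y}) x)" if "finite Y" for Y
      using that
    proof (induction Y rule: finite_induct)
      case empty
      have "indicator {} = (\<lambda>_::'a. 0::real)" by auto
      then show ?case using ind[of "{}"] bounded_measurable_zero by simp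
    next
      case (insert y Y)
      have "s -` {y} \<in> sets borel" using simple_functionD(2)[OF s, of "{y}"] by simp
      then have "indicator (s -` {y}) \<in> bounded_measurable" "P (indicator (s -` {y}))"
        by (auto intro: ind bounded_measurable_indicator)
      moreover have "(\<lambda>x. \<Sum>y\<in>insert y Y. y * indicator (s -` {y}) x) =
          (\<lambda>x. (\<Sum>y\<in>Y. y * indicator (s -` {y}) x) + y * indicator (s -` {y}) x)"
        by (simp only: sum.insert[OF insert.hyps] add.commute)
      ultimately show ?case
        using insert.IH by (simp only: lin bounded_measurable_lin)
    qed
    from this[of "range s"] have "(\<lambda>x. \<Sum>y\<in>range s. y * indicator (s -` {y}) x) \<in> bounded_measurable \<and>
        P (\<lambda>x. \<Sum>y\<in>range s. y * indicator (s -` {y}) x)"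
      using simple_functionD(1)[OF s] by simp
    moreover have "(\<Sum>y\<in>range s. y * indicator (s -` {y}) x) = s x" for x
    proof -
      have "(\<Sum>y\<in>range s. y * indicator (s -` {y}) x) = (\<Sum>y\<in>range s. if y = s x then y else 0)"
        by (intro sum.cong) (auto simp: indicator_def)
      then show ?thesis using simple_functionD(1)[OF s] by (simp add: sum.delta)
    qed
    ultimately show ?thesis by simp
  qed
  obtain F where F: "\<And>n. simple_function borel (F n)" "\<And>x. (\<lambda>n. F n x) \<longlonglongrightarrow> f x"
    "\<And>n x. norm (F n x) \<le> 2 * norm (f x)"
    using borel_measurable_implies_sequence_metric[of f borel 0] f
    by (auto simp: bounded_measurable_def)
  show ?thesis
  proof (rule lim[where F=F and K="2 * K"])
    show "\<bar>F n x\<bar> \<le> 2 * K" for n x using F(3)[of n x] K[of x] by simp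
  qed (use simple F in auto)
qed

section \<open>Finite signed measures as densities\<close>

text \<open>Here h is the sign function of the Hahn decomposition, 1 on H and -1 off H. Writing
  \<mu> as h times its total variation turns \<open>signed_integral\<close>, a difference of two
  integrals, into a single integral over a finite positive measure.\<close>

lemma finite_signed_measure_jordan:
  fixes \<mu> :: "'a::euclidean_space set \<Rightarrow> real"
  assumes \<mu>: "finite_signed_measure \<mu>"
  obtains h where "sets (total_variation \<mu>) = sets borel" "finite_measure (total_variation \<mu>)"
    "h \<in> borel_measurable borel" "\<And>x. \<bar>h x\<bar> \<le> 1"
    "\<And>A. A \<in> bounded_borel \<Longrightarrow> \<mu> A = (\<integral>x. indicator A x * h x \<partial>total_variation \<mu>)"
    "\<And>\<psi>. \<psi> \<in> bounded_measurable \<Longrightarrow> signed_integral \<mu> \<psi> = (\<integral>x. \<psi> x * h x \<partial>total_variation \<mu>)"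
proof -
  have sm: "signed_measure \<mu>" and fin: "emeasure (total_variation \<mu>) UNIV < \<infinity>"
    using \<mu> by (auto simp: finite_signed_measure_def)
  let ?T = "total_variation \<mu>"
  obtain H where T: "positive_measure ?T" and H[measurable]: "H \<in> sets borel"
    and TA: "\<And>A. A \<in> bounded_borel \<Longrightarrow> emeasure ?T A = ennreal (\<mu> (A \<inter> H) - \<mu> (A - H))"
    and \<mu>T: "\<And>A. A \<in> bounded_borel \<Longrightarrow> \<mu> A = measure ?T (A \<inter> H) - measure ?T (A - H)"
    and pv: "positive_variation \<mu> = density ?T (indicator H)"
      "positive_variation (\<lambda>A. - \<mu> A) = density ?T (indicator (- H))"
    by (rule jordan_decomposition[OF sm]) (rule that)
  have sT[simp, measurable_cong]: "sets ?T = sets borel" using T by (simp add: positive_measure_def)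
  have spT[simp]: "space ?T = UNIV" using sets_eq_imp_space_eq[OF sT] by simp
  interpret T: finite_measure ?T by (rule finite_measureI) (use fin in simp)
  define h :: "'a \<Rightarrow> real" where "h x = indicator H x - indicator (- H) x" for x
  have h[measurable]: "h \<in> borel_measurable borel" unfolding h_def by measurable
  have h1: "\<bar>h x\<bar> \<le> 1" for x by (auto simp: h_def indicator_def)
  have inth: "integrable ?T (\<lambda>x. \<psi> x * h x)" "integrable ?T \<psi>" if \<psi>: "\<psi> \<in> bounded_measurable" for \<psi>
  proof -
    obtain K where K: "\<And>x. \<bar>\<psi> x\<bar> \<le> K" "K \<ge> 0" using bounded_measurable_bound[OF \<psi>] by metis
    note [measurable] = bounded_measurable_measurable[OF \<psi>]
    show "integrable ?T (\<lambda>x. \<psi> x * h x)" "integrable ?T \<psi>"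
      by (rule T.integrable_const_bound[of _ K];
          use K mult_mono[OF K(1) h1 K(2)] in \<open>auto simp: abs_mult\<close>)+
  qed
  have si: "signed_integral \<mu> \<psi> = (\<integral>x. \<psi> x * h x \<partial>?T)" if \<psi>: "\<psi> \<in> bounded_measurable" for \<psi>
  proof -
    note [measurable] = bounded_measurable_measurable[OF \<psi>]
    have d: "(\<integral>x. \<psi> x \<partial>density ?T (indicator A)) = (\<integral>x. indicator A x * \<psi> x \<partial>?T)" if [measurable]: "A \<in> sets borel" for A
      using integral_density[of \<psi> ?T "indicator A"] by (simp add: ennreal_indicator)
    have i: "integrable ?T (\<lambda>x. indicator A x * \<psi> x)" if "A \<in> sets borel" for A
      using integrable_mult_indicator[OF _ inth(2)[OF \<psi>], of A] that by simp
    have "(\<integral>x. \<psi> x * h x \<partial>?T) = (\<integral>x. indicator H x * \<psi> x - indicator (- H) x * \<psi> x \<partial>?T)"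
      by (simp add: h_def algebra_simps)
    then show ?thesis unfolding signed_integral_def pv
      using H i[OF H] i[of "- H"] d[OF H] d[of "- H"] by auto
  qed
  show thesis
  proof (rule that[OF sT T.finite_measure_axioms h h1 _ si])
    fix C :: "'a set" assume C: "C \<in> bounded_borel"
    note [measurable] = bounded_borel_sets[OF C]
    have "(\<integral>x. indicator C x * h x \<partial>?T) = (\<integral>x. indicator (C \<inter> H) x - indicator (C - H) x \<partial>?T)"
      by (intro Bochner_Integration.integral_cong) (auto simp: h_def indicator_def)
    also have "\<dots> = measure ?T (C \<inter> H) - measure ?T (C - H)"
      by (subst Bochner_Integration.integral_diff) (auto intro: T.emeasure_finite simp: less_top[symmetric])
    finally show "\<mu> C = (\<integral>x. indicator C x * h x \<partial>?T)" using \<mu>T[OF C] by simp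
  qed
qed

text \<open>The map p gives room for both kinds of measure in the expansion: with L = T and p =
  \<open>fst\<close> a marginal with density, with p constant a Dirac measure. The integral formula
  compares two representations of \<mu>, one through g and one through its own Jordan density, by
  induction on the integrand.\<close>

lemma finite_signed_measure_density:
  fixes \<mu> :: "'a::euclidean_space set \<Rightarrow> real" and L :: "'b measure" and g :: "'b \<Rightarrow> real"
  assumes p[measurable]: "p \<in> measurable L borel" and g: "integrable L g"
    and \<mu>_eq: "\<And>A. A \<in> bounded_borel \<Longrightarrow> \<mu> A = (\<integral>z. indicator A (p z) * g z \<partial>L)"
  shows "finite_signed_measure \<mu>"
    and "\<phi> \<in> bounded_measurable \<Longrightarrow> signed_integral \<mu> \<phi> = (\<integral>z. \<phi> (p z) * g z \<partial>L)"
proof -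
  have g_meas[measurable]: "g \<in> borel_measurable L" using g by auto
  have intg: "integrable L (\<lambda>z. \<psi> (p z) * g z)" if \<psi>: "\<psi> \<in> bounded_measurable" for \<psi>
  proof -
    obtain K where K: "\<And>x. \<bar>\<psi> x\<bar> \<le> K" using bounded_measurable_bound[OF \<psi>] by metis
    note [measurable] = bounded_measurable_measurable[OF \<psi>]
    show ?thesis
      by (rule Bochner_Integration.integrable_bound[where f="\<lambda>z. K * g z"])
         (use g K in \<open>auto simp: abs_mult intro!: mult_right_mono order_trans[OF K abs_ge_self]\<close>)
  qed
  have sm: "signed_measure \<mu>"
    unfolding signed_measure_def
  proof safe
    fix A :: "nat \<Rightarrow> 'a set"
    assume A: "range A \<subseteq> bounded_borel" "disjoint_family A" "(\<Union>n. A n) \<in> bounded_borel"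
    have Ab: "A n \<in> bounded_borel" for n using A by auto
    have [measurable]: "A n \<in> sets borel" for n using Ab by (auto dest: bounded_borel_sets)
    have [measurable]: "(\<Union>n. A n) \<in> sets borel" using A(3) by (rule bounded_borel_sets)
    have "(\<lambda>n. \<integral>z. (\<Sum>i<n. indicator (A i) (p z)) * g z \<partial>L) \<longlonglongrightarrow> (\<integral>z. indicator (\<Union>n. A n) (p z) * g z \<partial>L)"
    proof (rule integral_dominated_convergence[where w="\<lambda>z. \<bar>g z\<bar>"])
      show "integrable L (\<lambda>z. \<bar>g z\<bar>)" using g by simp
      show "AE z in L. (\<lambda>n. (\<Sum>i<n. indicator (A i) (p z)) * g z) \<longlonglongrightarrow> indicator (\<Union>n. A n) (p z) * g z"
      proof (rule AE_I2)
        fix z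
        have "(\<lambda>i. indicator (A i) (p z)) sums (indicator (\<Union>n. A n) (p z) :: real)"
          using A(2) by (intro indicator_sums) (auto simp: disjoint_family_on_def)
        then show "(\<lambda>n. (\<Sum>i<n. indicator (A i) (p z)) * g z) \<longlonglongrightarrow> indicator (\<Union>n. A n) (p z) * g z"
          unfolding sums_def by (intro tendsto_mult tendsto_const)
      qed
      show "AE z in L. norm ((\<Sum>i<n. indicator (A i) (p z)) * g z) \<le> \<bar>g z\<bar>" for n
      proof (rule AE_I2)
        fix z
        have "(\<Sum>i<n. indicator (A i) (p z)) = (indicator (\<Union>i<n. A i) (p z) :: real)"
          using A(2) by (intro indicator_UN_disjoint[symmetric]) (auto simp: disjoint_family_on_def)
        then show "norm ((\<Sum>i<n. indicator (A i) (p z)) * g z) \<le> \<bar>g z\<bar>"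
          by (simp add: indicator_def)
      qed
      show "(\<lambda>z. indicator (\<Union>n. A n) (p z) * g z) \<in> borel_measurable L" by measurable
      show "(\<lambda>z. (\<Sum>i<n. indicator (A i) (p z)) * g z) \<in> borel_measurable L" for n by measurable
    qed
    moreover have "(\<integral>z. (\<Sum>i<n. indicator (A i) (p z)) * g z \<partial>L) = (\<Sum>i<n. \<mu> (A i))" for n
      unfolding sum_distrib_right \<mu>_eq[OF Ab]
      by (intro Bochner_Integration.integral_sum intg bounded_measurable_indicator) simp
    ultimately show "(\<lambda>n. \<mu> (A n)) sums \<mu> (\<Union>n. A n)"
      using \<mu>_eq[OF A(3)] by (simp add: sums_def)
  qed
  let ?T = "total_variation \<mu>"
  obtain H where T: "positive_measure ?T" and H: "H \<in> sets borel"
    and TA: "\<And>A. A \<in> bounded_borel \<Longrightarrow> emeasure ?T A = ennreal (\<mu> (A \<inter> H) - \<mu> (A - H))"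
    by (rule jordan_decomposition[OF sm]) (rule that)
  have sT0: "sets ?T = sets borel" using T by (simp add: positive_measure_def)
  have bound: "\<bar>\<mu> A\<bar> \<le> (\<integral>z. \<bar>g z\<bar> \<partial>L)" if A: "A \<in> bounded_borel" for A
  proof -
    have "\<bar>\<mu> A\<bar> \<le> (\<integral>z. \<bar>indicator A (p z) * g z\<bar> \<partial>L)"
      unfolding \<mu>_eq[OF A] by (rule integral_abs_bound)
    also have "\<dots> \<le> (\<integral>z. \<bar>g z\<bar> \<partial>L)"
      using g intg[OF bounded_measurable_indicator[OF bounded_borel_sets[OF A]]]
      by (intro integral_mono) (auto simp: indicator_def)
    finally show ?thesis .
  qed
  have "emeasure ?T UNIV = (SUP n. emeasure ?T (UNIV \<inter> ball 0 (real n)))"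
    by (rule emeasure_SUP_ball[symmetric, OF sT0]) auto
  \<comment> \<open>The factor 2 comes from bounding \<mu> on the parts inside and outside H
    separately, each by the integral of |g|.\<close>
  also have "\<dots> \<le> ennreal (2 * (\<integral>z. \<bar>g z\<bar> \<partial>L))"
  proof (rule SUP_least)
    fix n
    have b: "UNIV \<inter> ball 0 (real n) \<in> (bounded_borel :: 'a set set)" by (rule bounded_borel_Int_ball) simp
    show "emeasure ?T (UNIV \<inter> ball 0 (real n)) \<le> ennreal (2 * (\<integral>z. \<bar>g z\<bar> \<partial>L))"
      unfolding TA[OF b]
      using bound[OF bounded_borel_Int[OF b H]] bound[OF bounded_borel_Diff[OF b H]]
      by (intro ennreal_leI) linarith
  qed
  finally have fin: "emeasure ?T UNIV < \<infinity>" by (rule le_less_trans) simp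
  then show fsm: "finite_signed_measure \<mu>" using sm by (simp add: finite_signed_measure_def)
  obtain h where sT[measurable_cong]: "sets ?T = sets borel" and "finite_measure ?T"
    and h[measurable]: "h \<in> borel_measurable borel" and h1: "\<And>x. \<bar>h x\<bar> \<le> 1"
    and \<mu>h: "\<And>A. A \<in> bounded_borel \<Longrightarrow> \<mu> A = (\<integral>x. indicator A x * h x \<partial>?T)"
    and si: "\<And>\<psi>. \<psi> \<in> bounded_measurable \<Longrightarrow> signed_integral \<mu> \<psi> = (\<integral>x. \<psi> x * h x \<partial>?T)"
    by (rule finite_signed_measure_jordan[OF fsm]) (rule that)
  interpret T: finite_measure ?T by fact
  have inth: "integrable ?T (\<lambda>x. \<psi> x * h x)" if \<psi>: "\<psi> \<in> bounded_measurable" for \<psi>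
  proof -
    obtain K where K: "\<And>x. \<bar>\<psi> x\<bar> \<le> K" "K \<ge> 0" using bounded_measurable_bound[OF \<psi>] by metis
    note [measurable] = bounded_measurable_measurable[OF \<psi>]
    show ?thesis
      by (rule T.integrable_const_bound[of _ K])
         (use K mult_mono[OF K(1) h1 K(2)] in \<open>auto simp: abs_mult\<close>)
  qed
  have "signed_integral \<mu> \<phi> = (\<integral>z. \<phi> (p z) * g z \<partial>L)" if "\<phi> \<in> bounded_measurable"
    unfolding si[OF that] using that
  proof (induction rule: bounded_measurable_induct)
    case (lin \<phi> \<psi> c)
    then show ?case by (simp add: distrib_right inth intg mult.assoc)
  next
    case (lim F \<phi> K)
    then have [measurable]: "F n \<in> borel_measurable borel" for n by (auto dest: bounded_measurable_measurable)
    have [measurable]: "\<phi> \<in> borel_measurable borel"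
      by (rule borel_measurable_LIMSEQ_real[where u=F]) (use lim.hyps(3) in auto)
    have Fh: "\<bar>F n x * h x\<bar> \<le> K" for n x
      using mult_mono[OF lim.hyps(2)[of n x] h1[of x]] order_trans[OF abs_ge_zero lim.hyps(2)[of n x]]
      by (simp add: abs_mult)
    have "(\<lambda>n. \<integral>x. F n x * h x \<partial>?T) \<longlonglongrightarrow> (\<integral>x. \<phi> x * h x \<partial>?T)"
      by (rule integral_dominated_convergence[where w="\<lambda>_. K"])
         (use lim.hyps(3) Fh in \<open>auto intro!: tendsto_mult\<close>)
    moreover have "(\<lambda>n. \<integral>z. F n (p z) * g z \<partial>L) \<longlonglongrightarrow> (\<integral>z. \<phi> (p z) * g z \<partial>L)"
      by (rule integral_dominated_convergence[where w="\<lambda>z. K * \<bar>g z\<bar>"])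
         (use lim.hyps(2,3) g in \<open>auto simp: abs_mult intro!: tendsto_mult mult_right_mono\<close>)
    ultimately show ?case using lim.IH LIMSEQ_unique by simp
  next
    case (indicator A)
    \<comment> \<open>Both representations are known on bounded sets only, so A is exhausted by
      balls and both sides pass to the limit.\<close>
    have Ab: "A \<inter> ball 0 (real n) \<in> bounded_borel" for n using indicator by (rule bounded_borel_Int_ball)
    note ev = indicator_Int_ball_tendsto[of A]
    have ib: "\<bar>indicator C x * y\<bar> \<le> \<bar>y\<bar>" for C and x :: 'a and y :: real
      by (simp add: indicator_def)
    note [measurable] = indicator bounded_borel_sets[OF Ab]
    have "(\<lambda>n. \<integral>x. indicator (A \<inter> ball 0 (real n)) x * h x \<partial>?T) \<longlonglongrightarrow> (\<integral>x. indicator A x * h x \<partial>?T)"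
      by (rule integral_dominated_convergence[where w="\<lambda>_. 1"])
         (use ev order_trans[OF ib h1] in \<open>auto intro!: tendsto_mult\<close>)
    moreover have "(\<lambda>n. \<integral>z. indicator (A \<inter> ball 0 (real n)) (p z) * g z \<partial>L) \<longlonglongrightarrow> (\<integral>z. indicator A (p z) * g z \<partial>L)"
      by (rule integral_dominated_convergence[where w="\<lambda>z. \<bar>g z\<bar>"])
         (use ev g ib in \<open>auto intro!: tendsto_mult\<close>)
    ultimately show ?case using \<mu>_eq[OF Ab] \<mu>h[OF Ab] LIMSEQ_unique by simp
  qed
  then show "\<phi> \<in> bounded_measurable \<Longrightarrow> signed_integral \<mu> \<phi> = (\<integral>z. \<phi> (p z) * g z \<partial>L)" .
qed

section \<open>Mean-square completeness\<close>

lemma square_integrable_mult: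
  assumes "square_integrable P X" "square_integrable P Y"
  shows "integrable P (\<lambda>\<omega>. X \<omega> * Y \<omega>)"
proof (rule Bochner_Integration.integrable_bound[where f="\<lambda>\<omega>. (X \<omega>)\<^sup>2 + (Y \<omega>)\<^sup>2"])
  show "integrable P (\<lambda>\<omega>. (X \<omega>)\<^sup>2 + (Y \<omega>)\<^sup>2)" using assms by (simp add: square_integrable_def)
  show "(\<lambda>\<omega>. X \<omega> * Y \<omega>) \<in> borel_measurable P"
    using assms unfolding square_integrable_def by (intro borel_measurable_times) auto
  have "\<bar>a * b\<bar> \<le> a\<^sup>2 + b\<^sup>2" for a b :: real
    using sum_squares_bound[of a b] sum_squares_bound[of a "- b"] by (simp add: abs_le_iff)
  then show "AE \<omega> in P. norm (X \<omega> * Y \<omega>) \<le> norm ((X \<omega>)\<^sup>2 + (Y \<omega>)\<^sup>2)" by simp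
qed

lemma square_integrable_lin:
  assumes X: "square_integrable P X" and Y: "square_integrable P Y"
  shows "square_integrable P (\<lambda>\<omega>. X \<omega> + c * Y \<omega>)"
proof -
  have "(\<lambda>\<omega>. (X \<omega> + c * Y \<omega>)\<^sup>2) = (\<lambda>\<omega>. (X \<omega>)\<^sup>2 + 2 * c * (X \<omega> * Y \<omega>) + c\<^sup>2 * (Y \<omega>)\<^sup>2)"
    by (auto simp: power2_eq_square algebra_simps)
  moreover have "(\<lambda>\<omega>. X \<omega> + c * Y \<omega>) \<in> borel_measurable P"
    using X Y unfolding square_integrable_def by (intro borel_measurable_add borel_measurable_times) auto
  ultimately show ?thesis
    using X Y square_integrable_mult[OF X Y] by (simp add: square_integrable_def)
qed

lemma semi_inner_L2:
  "semi_inner {X. square_integrable P X} (\<lambda>X Y. \<integral>\<omega>. X \<omega> * Y \<omega> \<partial>P)"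
proof
  show "(\<lambda>_. 0) \<in> {X. square_integrable P X}" by (simp add: square_integrable_def)
next
  fix f g k :: "'a \<Rightarrow> real" and c
  assume "f \<in> {X. square_integrable P X}" "g \<in> {X. square_integrable P X}" "k \<in> {X. square_integrable P X}"
  then have "integrable P (\<lambda>\<omega>. f \<omega> * k \<omega>)" "integrable P (\<lambda>\<omega>. g \<omega> * k \<omega>)"
    by (auto intro: square_integrable_mult)
  then show "(\<integral>\<omega>. (f \<omega> + c * g \<omega>) * k \<omega> \<partial>P) = (\<integral>\<omega>. f \<omega> * k \<omega> \<partial>P) + c * (\<integral>\<omega>. g \<omega> * k \<omega> \<partial>P)"
    by (simp add: distrib_right mult.assoc)
qed (auto simp: mult.commute intro: square_integrable_lin)

text \<open>Along a rapidly Cauchy subsequence the increments are summable in \<open>L\<^sup>1\<close>, which gives an almost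
  sure limit; Fatou's lemma upgrades this to mean-square convergence.\<close>

lemma L2_complete:
  fixes Z :: "nat \<Rightarrow> 'w \<Rightarrow> real"
  assumes "prob_space P"
    and Z: "\<And>n. square_integrable P (Z n)"
    and Cauchy: "\<And>e. e > 0 \<Longrightarrow> \<exists>N. \<forall>m\<ge>N. \<forall>n\<ge>N. (\<integral>\<omega>. (Z m \<omega> - Z n \<omega>)\<^sup>2 \<partial>P) < e"
  obtains Y where "square_integrable P Y" "(\<lambda>n. \<integral>\<omega>. (Y \<omega> - Z n \<omega>)\<^sup>2 \<partial>P) \<longlonglongrightarrow> 0"
proof -
  interpret prob_space P by fact
  have Zm[measurable]: "Z n \<in> borel_measurable P" for n using Z[of n] by (simp add: square_integrable_def)
  have sq: "square_integrable P (\<lambda>\<omega>. Z m \<omega> - Z n \<omega>)" for m n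
    using square_integrable_lin[OF Z[of m] Z[of n], of "-1"] by simp
  then have isq: "integrable P (\<lambda>\<omega>. (Z m \<omega> - Z n \<omega>)\<^sup>2)" for m n by (simp add: square_integrable_def)
  \<comment> \<open>Squared distances below \<open>(1/4)^k\<close> yield first moments of size
    \<open>(1/2)^k\<close>, which are summable.\<close>
  have "\<exists>N. \<forall>m\<ge>N. \<forall>n\<ge>N. (\<integral>\<omega>. (Z m \<omega> - Z n \<omega>)\<^sup>2 \<partial>P) < (1/4)^k" for k by (rule Cauchy) simp
  then obtain N where N: "\<And>k m n. m \<ge> N k \<Longrightarrow> n \<ge> N k \<Longrightarrow> (\<integral>\<omega>. (Z m \<omega> - Z n \<omega>)\<^sup>2 \<partial>P) < (1/4)^k"
    by metis
  \<comment> \<open>Partial sums make the subsequence monotone while keeping it beyond each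
    \<open>N k\<close>.\<close>
  define r where "r k = (\<Sum>i\<le>k. N i)" for k
  have rN: "N k \<le> r k" for k unfolding r_def by (rule member_le_sum) auto
  have r_mono: "r k \<le> r (Suc k)" for k by (simp add: r_def)
  have "incseq r" using r_mono by (rule incseq_SucI)
  define D where "D k \<omega> = Z (r (Suc k)) \<omega> - Z (r k) \<omega>" for k \<omega>
  have Dm[measurable]: "D k \<in> borel_measurable P" for k unfolding D_def by measurable
  have Dsq: "integrable P (\<lambda>\<omega>. (D k \<omega>)\<^sup>2)" "(\<integral>\<omega>. (D k \<omega>)\<^sup>2 \<partial>P) < (1/4)^k" for k
    unfolding D_def using isq N[of k "r (Suc k)" "r k"] rN[of k] r_mono[of k] by auto
  have Dabs: "(\<integral>\<^sup>+\<omega>. ennreal \<bar>D k \<omega>\<bar> \<partial>P) \<le> ennreal ((1/2)^k)" for k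
  proof -
    \<comment> \<open>The inequality of arithmetic and geometric means with weight
      \<open>2^k\<close>, chosen to balance a second moment of size \<open>(1/4)^k\<close> against
      the constant \<open>(1/2)^k\<close>.\<close>
    have am: "\<bar>x\<bar> \<le> (2^k * x\<^sup>2 + (1/2)^k) / 2" for x :: real
    proof -
      have "0 \<le> 2^k * (\<bar>x\<bar> - (1/2)^k)\<^sup>2" by simp
      also have "\<dots> = 2^k * x\<^sup>2 - 2 * \<bar>x\<bar> * (2^k * (1/2)^k) + (2^k * (1/2)^k) * (1/2)^k"
        by (simp only: power2_diff power2_abs) (simp add: algebra_simps power2_eq_square)
      also have "2^k * (1/2)^k = (1::real)" by (simp add: power_one_over)
      finally show ?thesis by simp
    qed
    have i: "integrable P (\<lambda>\<omega>. (2^k * (D k \<omega>)\<^sup>2 + (1/2)^k) / 2)" using Dsq(1)[of k] by simp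
    have "(\<integral>\<^sup>+\<omega>. ennreal \<bar>D k \<omega>\<bar> \<partial>P) \<le> (\<integral>\<^sup>+\<omega>. ennreal ((2^k * (D k \<omega>)\<^sup>2 + (1/2)^k) / 2) \<partial>P)"
      by (intro nn_integral_mono ennreal_leI am)
    also have "\<dots> = ennreal (\<integral>\<omega>. (2^k * (D k \<omega>)\<^sup>2 + (1/2)^k) / 2 \<partial>P)"
      by (rule nn_integral_eq_integral[OF i]) simp
    also have "(\<integral>\<omega>. (2^k * (D k \<omega>)\<^sup>2 + (1/2)^k) / 2 \<partial>P) = (2^k * (\<integral>\<omega>. (D k \<omega>)\<^sup>2 \<partial>P) + (1/2)^k) / 2"
      using Dsq(1)[of k] by (simp add: prob_space)
    also have "\<dots> \<le> (2^k * (1/4)^k + (1/2)^k) / 2"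
      using Dsq(2)[of k] by simp
    also have "\<dots> = (1/2)^k" by (simp add: field_simps flip: power_mult_distrib)
    finally show ?thesis by (simp add: ennreal_leI)
  qed
  have "(\<integral>\<^sup>+\<omega>. (\<Sum>k. ennreal \<bar>D k \<omega>\<bar>) \<partial>P) = (\<Sum>k. \<integral>\<^sup>+\<omega>. ennreal \<bar>D k \<omega>\<bar> \<partial>P)"
    by (rule nn_integral_suminf) measurable
  also have "\<dots> \<le> (\<Sum>k. ennreal ((1/2)^k))" by (intro suminf_le Dabs) auto
  also have "\<dots> = ennreal 2"
    using geometric_sums[of "1/2 :: real"] by (intro suminf_ennreal_eq) auto
  finally have "(\<integral>\<^sup>+\<omega>. (\<Sum>k. ennreal \<bar>D k \<omega>\<bar>) \<partial>P) \<noteq> \<infinity>" by (auto simp: top_unique)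
  then have "AE \<omega> in P. (\<Sum>k. ennreal \<bar>D k \<omega>\<bar>) \<noteq> \<infinity>"
    by (intro nn_integral_noteq_infinite) measurable
  then have conv: "AE \<omega> in P. convergent (\<lambda>k. Z (r k) \<omega>)"
  proof eventually_elim
    case (elim \<omega>)
    then have "summable (\<lambda>k. \<bar>D k \<omega>\<bar>)" by (intro summable_suminf_not_top) auto
    then have "summable (\<lambda>k. D k \<omega>)" by (rule summable_rabs_cancel)
    then have "convergent (\<lambda>n. \<Sum>k<n. D k \<omega>)" by (simp add: summable_iff_convergent)
    then have "convergent (\<lambda>n. (\<Sum>k<n. D k \<omega>) + Z (r 0) \<omega>)" by (intro convergent_add convergent_const)
    moreover have "(\<Sum>k<n. D k \<omega>) + Z (r 0) \<omega> = Z (r n) \<omega>" for n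
      unfolding D_def by (subst sum_lessThan_telescope) simp
    ultimately show ?case by simp
  qed
  \<comment> \<open>Off the almost sure convergence set \<open>lim\<close> takes a fixed default
    value, so Y is measurable as a total function.\<close>
  define Y where "Y \<omega> = lim (\<lambda>k. Z (r k) \<omega>)" for \<omega>
  have Ym[measurable]: "Y \<in> borel_measurable P" unfolding Y_def by measurable
  have fatou: "(\<integral>\<^sup>+\<omega>. ennreal ((Y \<omega> - Z n \<omega>)\<^sup>2) \<partial>P) \<le> ennreal ((1/4)^k)" if n: "n \<ge> N k" for n k
  proof -
    have "(\<integral>\<^sup>+\<omega>. ennreal ((Y \<omega> - Z n \<omega>)\<^sup>2) \<partial>P) = (\<integral>\<^sup>+\<omega>. liminf (\<lambda>j. ennreal ((Z (r j) \<omega> - Z n \<omega>)\<^sup>2)) \<partial>P)"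
    proof (rule nn_integral_cong_AE, use conv in eventually_elim)
      fix \<omega> assume "convergent (\<lambda>k. Z (r k) \<omega>)"
      then have "(\<lambda>k. Z (r k) \<omega>) \<longlonglongrightarrow> Y \<omega>" by (simp add: Y_def convergent_LIMSEQ_iff)
      then have "(\<lambda>j. ennreal ((Z (r j) \<omega> - Z n \<omega>)\<^sup>2)) \<longlonglongrightarrow> ennreal ((Y \<omega> - Z n \<omega>)\<^sup>2)"
        by (intro tendsto_intros)
      then show "ennreal ((Y \<omega> - Z n \<omega>)\<^sup>2) = liminf (\<lambda>j. ennreal ((Z (r j) \<omega> - Z n \<omega>)\<^sup>2))"
        by (intro lim_imp_Liminf[symmetric]) auto
    qed
    also have "\<dots> \<le> liminf (\<lambda>j. \<integral>\<^sup>+\<omega>. ennreal ((Z (r j) \<omega> - Z n \<omega>)\<^sup>2) \<partial>P)"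
      by (rule nn_integral_liminf) measurable
    also have "\<dots> \<le> limsup (\<lambda>j. \<integral>\<^sup>+\<omega>. ennreal ((Z (r j) \<omega> - Z n \<omega>)\<^sup>2) \<partial>P)"
      by (rule Liminf_le_Limsup) simp
    also have "\<dots> \<le> ennreal ((1/4)^k)"
    proof (rule Limsup_bounded, rule eventually_sequentiallyI[of k])
      fix j assume "j \<ge> k"
      then have "r j \<ge> N k" using rN[of k] incseqD[OF \<open>incseq r\<close>, of k j] by linarith
      then show "(\<integral>\<^sup>+\<omega>. ennreal ((Z (r j) \<omega> - Z n \<omega>)\<^sup>2) \<partial>P) \<le> ennreal ((1/4)^k)"
        using N[of k "r j" n] n by (subst nn_integral_eq_integral[OF isq]) (auto intro: ennreal_leI)
    qed
    finally show ?thesis .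
  qed
  have int_diff: "integrable P (\<lambda>\<omega>. (Y \<omega> - Z n \<omega>)\<^sup>2) \<and> (\<integral>\<omega>. (Y \<omega> - Z n \<omega>)\<^sup>2 \<partial>P) \<le> (1/4)^k"
    if n: "n \<ge> N k" for n k
  proof
    show i: "integrable P (\<lambda>\<omega>. (Y \<omega> - Z n \<omega>)\<^sup>2)"
      by (rule integrableI_nonneg) (use le_less_trans[OF fatou[OF n]] in auto)
    show "(\<integral>\<omega>. (Y \<omega> - Z n \<omega>)\<^sup>2 \<partial>P) \<le> (1/4)^k"
      using fatou[OF n] by (subst (asm) nn_integral_eq_integral[OF i]) auto
  qed
  show thesis
  proof
    have "square_integrable P (\<lambda>\<omega>. Y \<omega> - Z (N 0) \<omega>)"
      using int_diff[of 0 "N 0"] by (simp add: square_integrable_def)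
    from square_integrable_lin[OF this Z, of 1 "N 0"] show "square_integrable P Y" by simp
    show "(\<lambda>n. \<integral>\<omega>. (Y \<omega> - Z n \<omega>)\<^sup>2 \<partial>P) \<longlonglongrightarrow> 0"
    proof (rule LIMSEQ_I)
      fix e :: real assume "e > 0"
      then obtain k where k: "(1/4)^k < e" using real_arch_pow_inv[of e "1/4"] by auto
      have "norm ((\<integral>\<omega>. (Y \<omega> - Z n \<omega>)\<^sup>2 \<partial>P) - 0) < e" if "n \<ge> N k" for n
        using int_diff[OF that] k by simp
      then show "\<exists>n0. \<forall>n\<ge>n0. norm ((\<integral>\<omega>. (Y \<omega> - Z n \<omega>)\<^sup>2 \<partial>P) - 0) < e" by blast
    qed
  qed
qed

section \<open>The covariance form of a finite random measure\<close>

text \<open>The covariance measure enters as h times its total variation T. \<open>M_cov\<close>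
  thus expresses covariances by integrals over a finite positive measure.\<close>

locale finite_random_measure = prob_space P
  for P :: "'w measure" and M :: "'a::euclidean_space set \<Rightarrow> 'w \<Rightarrow> real"
    and T :: "('a \<times> 'a) measure" and h :: "'a \<times> 'a \<Rightarrow> real" +
  assumes M_sq: "A \<in> bounded_borel \<Longrightarrow> square_integrable P (M A)"
    and M_mean: "A \<in> bounded_borel \<Longrightarrow> expectation (M A) = 0"
    and T_eq: "T = total_variation (covariance_measure P M)"
    and sets_T: "sets T = sets borel"
    and finite_T: "finite_measure T"
    and h_measurable [measurable]: "h \<in> borel_measurable borel"
    and h_bound: "\<bar>h z\<bar> \<le> 1"
    and M_cov: "A \<in> bounded_borel \<Longrightarrow> B \<in> bounded_borel \<Longrightarrow>
      expectation (\<lambda>\<omega>. M A \<omega> * M B \<omega>) = (\<integral>z. indicator (A \<times> B) z * h z \<partial>T)"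
begin

sublocale T: finite_measure T by (rule finite_T)

declare sets_T [measurable_cong]

lemma fst_measurable [measurable]: "fst \<in> measurable T borel"
  and snd_measurable [measurable]: "snd \<in> measurable T borel"
  unfolding measurable_cong_sets[OF sets_T refl] borel_prod[symmetric] by auto

text \<open>The form B of the overview, with C replaced by h times T.\<close>

definition cov_form :: "('a \<Rightarrow> real) \<Rightarrow> ('a \<Rightarrow> real) \<Rightarrow> real" where
  "cov_form \<phi> \<psi> = (\<integral>z. \<phi> (fst z) * (\<psi> (snd z) * h z) \<partial>T)"

text \<open>The inner product of \<open>L\<^sup>2\<close> over the sum of the two marginals of the total variation.\<close>

definition marginal_form :: "('a \<Rightarrow> real) \<Rightarrow> ('a \<Rightarrow> real) \<Rightarrow> real" where
  "marginal_form \<phi> \<psi> = (\<integral>z. \<phi> (fst z) * \<psi> (fst z) + \<phi> (snd z) * \<psi> (snd z) \<partial>T)"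

lemma integrable_cov_form:
  assumes "\<phi> \<in> bounded_measurable" "\<psi> \<in> bounded_measurable"
  shows "integrable T (\<lambda>z. \<phi> (fst z) * (\<psi> (snd z) * h z))"
proof -
  obtain K L where K: "K \<ge> 0" "\<And>x. \<bar>\<phi> x\<bar> \<le> K" and L: "L \<ge> 0" "\<And>x. \<bar>\<psi> x\<bar> \<le> L"
    using bounded_measurable_bound[OF assms(1)] bounded_measurable_bound[OF assms(2)] by metis
  note [measurable] = assms[THEN bounded_measurable_measurable]
  have "\<bar>\<phi> (fst z) * (\<psi> (snd z) * h z)\<bar> \<le> K * (L * 1)" for z
    unfolding abs_mult using K L h_bound by (intro mult_mono) auto
  then show ?thesis by (intro T.integrable_const_bound[of _ "K * (L * 1)"]) auto
qed

lemma integrable_marginal_form: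
  assumes "\<phi> \<in> bounded_measurable" "\<psi> \<in> bounded_measurable"
  shows "integrable T (\<lambda>z. \<phi> (fst z) * \<psi> (fst z) + \<phi> (snd z) * \<psi> (snd z))"
proof -
  obtain K L where K: "K \<ge> 0" "\<And>x. \<bar>\<phi> x\<bar> \<le> K" and L: "L \<ge> 0" "\<And>x. \<bar>\<psi> x\<bar> \<le> L"
    using bounded_measurable_bound[OF assms(1)] bounded_measurable_bound[OF assms(2)] by metis
  note [measurable] = assms[THEN bounded_measurable_measurable]
  have "\<bar>\<phi> x * \<psi> x\<bar> \<le> K * L" for x
    unfolding abs_mult using K L by (intro mult_mono) auto
  then show ?thesis
    by (intro Bochner_Integration.integrable_add T.integrable_const_bound[of _ "K * L"]) auto
qed

sublocale N: semi_inner bounded_measurable marginal_form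
proof
  fix \<phi> \<psi> \<theta> :: "'a \<Rightarrow> real" and c :: real
  assume a: "\<phi> \<in> bounded_measurable" "\<psi> \<in> bounded_measurable" "\<theta> \<in> bounded_measurable"
  have "marginal_form (\<lambda>x. \<phi> x + c * \<psi> x) \<theta> = (\<integral>z. (\<phi> (fst z) * \<theta> (fst z) + \<phi> (snd z) * \<theta> (snd z)) +
      c * (\<psi> (fst z) * \<theta> (fst z) + \<psi> (snd z) * \<theta> (snd z)) \<partial>T)"
    unfolding marginal_form_def by (intro Bochner_Integration.integral_cong) (auto simp: algebra_simps)
  then show "marginal_form (\<lambda>x. \<phi> x + c * \<psi> x) \<theta> = marginal_form \<phi> \<theta> + c * marginal_form \<psi> \<theta>"
    using integrable_marginal_form[OF a(1,3)] integrable_marginal_form[OF a(2,3)]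
    by (simp add: marginal_form_def)
next
  fix \<phi> :: "'a \<Rightarrow> real"
  show "0 \<le> marginal_form \<phi> \<phi>"
    unfolding marginal_form_def by (intro Bochner_Integration.integral_nonneg) auto
qed (auto simp: marginal_form_def mult.commute bounded_measurable_zero bounded_measurable_lin)

lemma cov_form_lin_left:
  assumes "\<phi> \<in> bounded_measurable" "\<psi> \<in> bounded_measurable" "\<theta> \<in> bounded_measurable"
  shows "cov_form (\<lambda>x. \<phi> x + c * \<psi> x) \<theta> = cov_form \<phi> \<theta> + c * cov_form \<psi> \<theta>"
proof -
  have "cov_form (\<lambda>x. \<phi> x + c * \<psi> x) \<theta> =
      (\<integral>z. \<phi> (fst z) * (\<theta> (snd z) * h z) + c * (\<psi> (fst z) * (\<theta> (snd z) * h z)) \<partial>T)"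
    unfolding cov_form_def by (intro Bochner_Integration.integral_cong) (auto simp: algebra_simps)
  then show ?thesis
    using integrable_cov_form[OF assms(1,3)] integrable_cov_form[OF assms(2,3)] by (simp add: cov_form_def)
qed

lemma cov_form_lin_right:
  assumes "\<phi> \<in> bounded_measurable" "\<psi> \<in> bounded_measurable" "\<theta> \<in> bounded_measurable"
  shows "cov_form \<theta> (\<lambda>x. \<phi> x + c * \<psi> x) = cov_form \<theta> \<phi> + c * cov_form \<theta> \<psi>"
proof -
  have "cov_form \<theta> (\<lambda>x. \<phi> x + c * \<psi> x) =
      (\<integral>z. \<theta> (fst z) * (\<phi> (snd z) * h z) + c * (\<theta> (fst z) * (\<psi> (snd z) * h z)) \<partial>T)"
    unfolding cov_form_def by (intro Bochner_Integration.integral_cong) (auto simp: algebra_simps)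
  then show ?thesis
    using integrable_cov_form[OF assms(3,1)] integrable_cov_form[OF assms(3,2)] by (simp add: cov_form_def)
qed

text \<open>Since |h| is at most 1, this is \<open>2 * |a * b| \<le> a^2 + b^2\<close> at the two
  coordinates. Every approximation in \<open>marginal_form\<close> is therefore one in
  \<open>cov_form\<close>.\<close>

lemma cov_form_le:
  assumes "\<phi> \<in> bounded_measurable"
  shows "cov_form \<phi> \<phi> \<le> marginal_form \<phi> \<phi>"
  unfolding cov_form_def marginal_form_def
proof (intro integral_mono integrable_cov_form integrable_marginal_form assms)
  fix z
  have "\<phi> (fst z) * (\<phi> (snd z) * h z) \<le> \<bar>\<phi> (fst z)\<bar> * (\<bar>\<phi> (snd z)\<bar> * \<bar>h z\<bar>)"
    by (simp flip: abs_mult)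
  also have "\<dots> \<le> \<bar>\<phi> (fst z)\<bar> * (\<bar>\<phi> (snd z)\<bar> * 1)"
    using h_bound by (intro mult_left_mono) auto
  also have "\<dots> \<le> \<phi> (fst z) * \<phi> (fst z) + \<phi> (snd z) * \<phi> (snd z)"
  proof -
    have "2 * (\<bar>\<phi> (fst z)\<bar> * \<bar>\<phi> (snd z)\<bar>) \<le> \<phi> (fst z) * \<phi> (fst z) + \<phi> (snd z) * \<phi> (snd z)"
      using sum_squares_bound[of "\<bar>\<phi> (fst z)\<bar>" "\<bar>\<phi> (snd z)\<bar>"] by (simp add: power2_eq_square)
    moreover have "0 \<le> \<bar>\<phi> (fst z)\<bar> * \<bar>\<phi> (snd z)\<bar>" by simp
    ultimately show ?thesis by linarith
  qed
  finally show "\<phi> (fst z) * (\<phi> (snd z) * h z) \<le> \<phi> (fst z) * \<phi> (fst z) + \<phi> (snd z) * \<phi> (snd z)" .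
qed

lemma marginal_form_tendsto_zero:
  assumes F: "\<And>n. F n \<in> bounded_measurable" and \<phi>: "\<phi> \<in> bounded_measurable"
    and K: "\<And>n x. \<bar>F n x\<bar> \<le> K" and lim: "\<And>x. (\<lambda>n. F n x) \<longlonglongrightarrow> \<phi> x"
  shows "(\<lambda>n. marginal_form (\<lambda>x. F n x - \<phi> x) (\<lambda>x. F n x - \<phi> x)) \<longlonglongrightarrow> 0"
proof -
  obtain L where L: "L \<ge> 0" "\<And>x. \<bar>\<phi> x\<bar> \<le> L" using bounded_measurable_bound[OF \<phi>] by metis
  have K0: "0 \<le> K" using K[of 0 0] by simp
  note [measurable] = bounded_measurable_measurable[OF F] bounded_measurable_measurable[OF \<phi>]
  have sq: "(F n x - \<phi> x) * (F n x - \<phi> x) \<le> (K + L) * (K + L)" for n x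
  proof -
    have "\<bar>F n x - \<phi> x\<bar> \<le> K + L" using K[of n x] L(2)[of x] by linarith
    then have "\<bar>F n x - \<phi> x\<bar> * \<bar>F n x - \<phi> x\<bar> \<le> (K + L) * (K + L)" using K0 L by (intro mult_mono) auto
    then show ?thesis by (simp flip: abs_mult)
  qed
  have "(\<lambda>n. \<integral>z. (F n (fst z) - \<phi> (fst z)) * (F n (fst z) - \<phi> (fst z)) +
      (F n (snd z) - \<phi> (snd z)) * (F n (snd z) - \<phi> (snd z)) \<partial>T) \<longlonglongrightarrow> (\<integral>z. 0 \<partial>T)"
  proof (rule integral_dominated_convergence[where w="\<lambda>_. 2 * ((K + L) * (K + L))"])
    have "(\<lambda>n. (F n x - \<phi> x) * (F n x - \<phi> x)) \<longlonglongrightarrow> (\<phi> x - \<phi> x) * (\<phi> x - \<phi> x)" for x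
      using lim by (intro tendsto_intros)
    from tendsto_add[OF this this]
    show "AE z in T. (\<lambda>n. (F n (fst z) - \<phi> (fst z)) * (F n (fst z) - \<phi> (fst z)) +
      (F n (snd z) - \<phi> (snd z)) * (F n (snd z) - \<phi> (snd z))) \<longlonglongrightarrow> 0" by simp
    have "norm ((F n x - \<phi> x) * (F n x - \<phi> x) + (F n y - \<phi> y) * (F n y - \<phi> y)) \<le> 2 * ((K + L) * (K + L))" for n x y
      using sq[of n x] sq[of n y] by simp
    then show "AE z in T. norm ((F n (fst z) - \<phi> (fst z)) * (F n (fst z) - \<phi> (fst z)) +
      (F n (snd z) - \<phi> (snd z)) * (F n (snd z) - \<phi> (snd z))) \<le> 2 * ((K + L) * (K + L))" for n by simp
  qed auto
  then show ?thesis by (simp add: marginal_form_def)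
qed

lemma cov_form_tendsto:
  assumes F: "\<And>n. F n \<in> bounded_measurable" and G: "\<And>n. G n \<in> bounded_measurable"
    and \<phi>: "\<phi> \<in> bounded_measurable" and \<psi>: "\<psi> \<in> bounded_measurable"
    and K: "\<And>n x. \<bar>F n x\<bar> \<le> K" and L: "\<And>n x. \<bar>G n x\<bar> \<le> L"
    and limF: "\<And>x. (\<lambda>n. F n x) \<longlonglongrightarrow> \<phi> x" and limG: "\<And>x. (\<lambda>n. G n x) \<longlonglongrightarrow> \<psi> x"
  shows "(\<lambda>n. cov_form (F n) (G n)) \<longlonglongrightarrow> cov_form \<phi> \<psi>"
  unfolding cov_form_def
proof (rule integral_dominated_convergence[where w="\<lambda>_. K * (L * 1)"])
  note [measurable] = assms(1-4)[THEN bounded_measurable_measurable]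
  show "(\<lambda>z. \<phi> (fst z) * (\<psi> (snd z) * h z)) \<in> borel_measurable T" by measurable
  show "(\<lambda>z. F n (fst z) * (G n (snd z) * h z)) \<in> borel_measurable T" for n by measurable
  show "AE z in T. (\<lambda>n. F n (fst z) * (G n (snd z) * h z)) \<longlonglongrightarrow> \<phi> (fst z) * (\<psi> (snd z) * h z)"
    using limF limG by (auto intro!: tendsto_intros)
  have "0 \<le> K" "0 \<le> L" using K[of 0 0] L[of 0 0] by auto
  then have "\<bar>F n (fst z) * (G n (snd z) * h z)\<bar> \<le> K * (L * 1)" for n z
    unfolding abs_mult using K L h_bound by (intro mult_mono) auto
  then show "AE z in T. norm (F n (fst z) * (G n (snd z) * h z)) \<le> K * (L * 1)" for n by simp
qed simp

sublocale L2: semi_inner "{X. square_integrable P X}" "\<lambda>X Y. expectation (\<lambda>\<omega>. X \<omega> * Y \<omega>)"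
  by (rule semi_inner_L2)

section \<open>The integral of simple functions and its isometry\<close>

lemma bounded_simple_vimage:
  assumes "bounded_simple s" "y \<noteq> 0"
  shows "s -` {y} \<in> bounded_borel"
proof -
  have "s -` {y} \<in> sets borel"
    using simple_functionD(2)[of borel s "{y}"] assms by (simp add: bounded_simple_def)
  moreover have "bounded (s -` {y})"
    using assms by (auto simp: bounded_simple_def intro: bounded_subset[of "{x. s x \<noteq> 0}"])
  ultimately show ?thesis by (simp add: bounded_borel_def)
qed

lemma bounded_simple_finite: "bounded_simple s \<Longrightarrow> finite (range s)"
  using simple_functionD(1)[of borel s] by (simp add: bounded_simple_def)

lemma bounded_simple_bounded_measurable:
  assumes "bounded_simple s"
  shows "s \<in> bounded_measurable"
  using assms bounded_simple_finite[OF assms]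
  by (auto simp: bounded_measurable_def bounded_simple_def finite_imp_bounded intro: borel_measurable_simple_function)

lemma bounded_simple_expansion:
  assumes "bounded_simple s"
  shows "s = (\<lambda>x. \<Sum>y\<in>range s - {0}. y * indicator (s -` {y}) x)"
proof
  fix x
  have "(\<Sum>y\<in>range s - {0}. y * indicator (s -` {y}) x) = (\<Sum>y\<in>range s - {0}. if y = s x then y else 0)"
    by (intro sum.cong) (auto simp: indicator_def)
  then show "s x = (\<Sum>y\<in>range s - {0}. y * indicator (s -` {y}) x)"
    using bounded_simple_finite[OF assms] by (simp add: sum.delta)
qed

lemma rm_simple_integral_square_integrable:
  assumes "bounded_simple s"
  shows "square_integrable P (rm_simple_integral M s)"
proof -
  have "(\<lambda>\<omega>. \<Sum>y\<in>range s - {0}. y * M (s -` {y}) \<omega>) \<in> {X. square_integrable P X}"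
    using bounded_simple_finite[OF assms] M_sq bounded_simple_vimage[OF assms]
    by (intro L2.sum_closed) auto
  then show ?thesis by (simp add: rm_simple_integral_def[abs_def])
qed

lemma expectation_rm_simple_integral:
  assumes "bounded_simple s"
  shows "expectation (rm_simple_integral M s) = 0"
proof -
  \<comment> \<open>Pairing with the constant 1 presents the mean as a value of the inner product,
    so \<open>L2.sum_left\<close> gives its linearity.\<close>
  have one: "square_integrable P (\<lambda>_. 1)" by (simp add: square_integrable_def)
  have "expectation (\<lambda>\<omega>. (\<Sum>y\<in>range s - {0}. y * M (s -` {y}) \<omega>) * 1) =
      (\<Sum>y\<in>range s - {0}. y * expectation (\<lambda>\<omega>. M (s -` {y}) \<omega> * 1))"
    using bounded_simple_finite[OF assms] M_sq bounded_simple_vimage[OF assms] one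
    by (intro L2.sum_left) auto
  then show ?thesis
    using M_mean[OF bounded_simple_vimage[OF assms]] by (simp add: rm_simple_integral_def[abs_def])
qed

text \<open>Proved directly from \<open>cov_form_lin_left\<close>: that \<open>cov_form\<close> is a
  semi-inner product is itself deduced later from the isometry, which rests on this
  expansion.\<close>

lemma cov_form_sum_left:
  assumes "finite J" "\<And>j. j \<in> J \<Longrightarrow> f j \<in> bounded_measurable" "\<psi> \<in> bounded_measurable"
  shows "cov_form (\<lambda>x. \<Sum>j\<in>J. c j * f j x) \<psi> = (\<Sum>j\<in>J. c j * cov_form (f j) \<psi>)"
  using assms(1,2)
proof (induction J rule: finite_induct)
  case empty
  show ?case by (simp add: cov_form_def)
next
  case (insert i J)
  have "cov_form (\<lambda>x. (\<Sum>j\<in>J. c j * f j x) + c i * f i x) \<psi> =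
      cov_form (\<lambda>x. \<Sum>j\<in>J. c j * f j x) \<psi> + c i * cov_form (f i) \<psi>"
    using insert assms(3) by (intro cov_form_lin_left N.sum_closed) auto
  then show ?case using insert by (simp add: add.commute)
qed

lemma cov_form_sum_right:
  assumes "finite J" "\<And>j. j \<in> J \<Longrightarrow> f j \<in> bounded_measurable" "\<psi> \<in> bounded_measurable"
  shows "cov_form \<psi> (\<lambda>x. \<Sum>j\<in>J. c j * f j x) = (\<Sum>j\<in>J. c j * cov_form \<psi> (f j))"
  using assms(1,2)
proof (induction J rule: finite_induct)
  case empty
  show ?case by (simp add: cov_form_def)
next
  case (insert i J)
  have "cov_form \<psi> (\<lambda>x. (\<Sum>j\<in>J. c j * f j x) + c i * f i x) =
      cov_form \<psi> (\<lambda>x. \<Sum>j\<in>J. c j * f j x) + c i * cov_form \<psi> (f i)"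
    using insert assms(3) by (intro cov_form_lin_right N.sum_closed) auto
  then show ?case using insert by (simp add: add.commute)
qed

text \<open>Both sides are expanded bilinearly along the canonical representations of s and t, which
  leaves the case of two indicators, that is \<open>M_cov\<close>.\<close>

lemma rm_simple_integral_cov:
  assumes s: "bounded_simple s" and t: "bounded_simple t"
  shows "expectation (\<lambda>\<omega>. rm_simple_integral M s \<omega> * rm_simple_integral M t \<omega>) = cov_form s t"
proof -
  let ?S = "range s - {0}" and ?T = "range t - {0}"
  have fin: "finite ?S" "finite ?T" using s t by (auto dest: bounded_simple_finite)
  have sb: "s -` {y} \<in> bounded_borel" if "y \<in> ?S" for y using bounded_simple_vimage[OF s, of y] that by auto
  have tb: "t -` {y} \<in> bounded_borel" if "y \<in> ?T" for y using bounded_simple_vimage[OF t, of y] that by auto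
  \<comment> \<open>The factors are swapped because t is expanded in the left argument by
    \<open>L2.sum_left\<close>.\<close>
  have ind: "cov_form (indicator A) (indicator B) = expectation (\<lambda>\<omega>. M B \<omega> * M A \<omega>)"
    if "A \<in> bounded_borel" "B \<in> bounded_borel" for A B
    unfolding mult.commute[of "M B _"] M_cov[OF that] cov_form_def
    by (intro Bochner_Integration.integral_cong) (auto simp: indicator_def)
  have "cov_form s t = cov_form (\<lambda>x. \<Sum>y\<in>?S. y * indicator (s -` {y}) x) (\<lambda>x. \<Sum>y\<in>?T. y * indicator (t -` {y}) x)"
    using bounded_simple_expansion[OF s] bounded_simple_expansion[OF t] by simp
  also have "\<dots> = (\<Sum>y\<in>?S. y * (\<Sum>z\<in>?T. z * cov_form (indicator (s -` {y})) (indicator (t -` {z}))))"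
  proof (subst cov_form_sum_left[OF fin(1)])
    have ib: "indicator A \<in> bounded_measurable" if "A \<in> bounded_borel" for A :: "'a set"
      using that by (intro bounded_measurable_indicator bounded_borel_sets)
    show "(\<lambda>x. \<Sum>y\<in>?T. y * indicator (t -` {y}) x) \<in> bounded_measurable"
      by (intro N.sum_closed fin ib tb)
    show "indicator (s -` {y}) \<in> bounded_measurable" if "y \<in> ?S" for y
      by (intro ib sb that)
    show "(\<Sum>y\<in>?S. y * cov_form (indicator (s -` {y})) (\<lambda>x. \<Sum>y\<in>?T. y * indicator (t -` {y}) x)) =
        (\<Sum>y\<in>?S. y * (\<Sum>z\<in>?T. z * cov_form (indicator (s -` {y})) (indicator (t -` {z}))))"
      by (intro sum.cong refl arg_cong2[where f="(*)"] cov_form_sum_right fin ib sb tb)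
  qed
  also have "\<dots> = (\<Sum>y\<in>?S. y * (\<Sum>z\<in>?T. z * expectation (\<lambda>\<omega>. M (t -` {z}) \<omega> * M (s -` {y}) \<omega>)))"
    using ind sb tb by (intro sum.cong) auto
  also have "\<dots> = (\<Sum>y\<in>?S. y * expectation (\<lambda>\<omega>. M (s -` {y}) \<omega> * rm_simple_integral M t \<omega>))"
  proof (intro sum.cong refl arg_cong2[where f="(*)"])
    fix y assume y: "y \<in> ?S"
    have "expectation (\<lambda>\<omega>. (\<Sum>z\<in>?T. z * M (t -` {z}) \<omega>) * M (s -` {y}) \<omega>) =
        (\<Sum>z\<in>?T. z * expectation (\<lambda>\<omega>. M (t -` {z}) \<omega> * M (s -` {y}) \<omega>))"
      using fin M_sq sb[OF y] tb by (intro L2.sum_left) auto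
    then show "(\<Sum>z\<in>?T. z * expectation (\<lambda>\<omega>. M (t -` {z}) \<omega> * M (s -` {y}) \<omega>)) =
        expectation (\<lambda>\<omega>. M (s -` {y}) \<omega> * rm_simple_integral M t \<omega>)"
      by (simp add: rm_simple_integral_def mult.commute)
  qed
  also have "\<dots> = expectation (\<lambda>\<omega>. (\<Sum>y\<in>?S. y * M (s -` {y}) \<omega>) * rm_simple_integral M t \<omega>)"
    using fin M_sq sb rm_simple_integral_square_integrable[OF t]
    by (intro L2.sum_left[symmetric]) auto
  finally show ?thesis by (simp add: rm_simple_integral_def)
qed

text \<open>The square is expanded into covariances, so the canonical representations of s and t
  never have to be refined to a common one.\<close>

lemma rm_simple_integral_dist:
  assumes s: "bounded_simple s" and t: "bounded_simple t"
  shows "expectation (\<lambda>\<omega>. (rm_simple_integral M s \<omega> - rm_simple_integral M t \<omega>)\<^sup>2)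
    \<le> marginal_form (\<lambda>x. s x - t x) (\<lambda>x. s x - t x)"
proof -
  note b = bounded_simple_bounded_measurable[OF s] bounded_simple_bounded_measurable[OF t]
  have cl: "(\<lambda>x. s x - t x) \<in> bounded_measurable" using b by (rule N.diff_closed)
  have sym: "cov_form s t = cov_form t s"
    using rm_simple_integral_cov[OF s t] rm_simple_integral_cov[OF t s] by (simp add: mult.commute)
  have "expectation (\<lambda>\<omega>. (rm_simple_integral M s \<omega> - rm_simple_integral M t \<omega>)\<^sup>2) =
      cov_form s s - 2 * cov_form s t + cov_form t t"
    unfolding power2_eq_square using s t rm_simple_integral_square_integrable
    by (subst L2.form_diff) (auto simp: rm_simple_integral_cov)
  also have "\<dots> = cov_form (\<lambda>x. s x - t x) (\<lambda>x. s x - t x)"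
    using cov_form_lin_left[OF b cl, of "-1"] cov_form_lin_right[OF b b(1), of "-1"]
      cov_form_lin_right[OF b b(2), of "-1"] sym by simp
  also have "\<dots> \<le> marginal_form (\<lambda>x. s x - t x) (\<lambda>x. s x - t x)" using cl by (rule cov_form_le)
  finally show ?thesis .
qed

end

text \<open>\<open>is_rm_integral\<close> admits only approximations with |s n| \<le> |\<phi>|, so
  the values are rounded towards zero: |\<phi>| is rounded down to a multiple of 1 / (n + 1), the
  sign is restored, and the result is cut off outside the ball of radius n.\<close>

lemma bounded_simple_approximation:
  fixes \<phi> :: "'a::euclidean_space \<Rightarrow> real"
  assumes \<phi>: "\<phi> \<in> bounded_measurable"
  obtains s where "\<And>n::nat. bounded_simple (s n)" "\<And>x. (\<lambda>n. s n x) \<longlonglongrightarrow> \<phi> x"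
    "\<And>n x. \<bar>s n x\<bar> \<le> \<bar>\<phi> x\<bar>"
proof -
  obtain K where K: "K \<ge> 0" "\<And>x. \<bar>\<phi> x\<bar> \<le> K" using bounded_measurable_bound[OF \<phi>] by metis
  note [measurable] = bounded_measurable_measurable[OF \<phi>]
  define q where "q n x = of_int \<lfloor>real (Suc n) * \<bar>\<phi> x\<bar>\<rfloor> / real (Suc n)" for n x
  define s where "s n x = sgn (\<phi> x) * q n x * indicator (ball 0 (real n)) x" for n x
  have q: "0 \<le> q n x" "q n x \<le> \<bar>\<phi> x\<bar>" "\<bar>\<phi> x\<bar> - 1 / real (Suc n) \<le> q n x" for n x
  proof -
    have f: "of_int \<lfloor>real (Suc n) * \<bar>\<phi> x\<bar>\<rfloor> \<le> real (Suc n) * \<bar>\<phi> x\<bar>"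
      "real (Suc n) * \<bar>\<phi> x\<bar> - 1 \<le> of_int \<lfloor>real (Suc n) * \<bar>\<phi> x\<bar>\<rfloor>"
      by linarith+
    show "0 \<le> q n x" by (simp add: q_def)
    show "q n x \<le> \<bar>\<phi> x\<bar>" unfolding q_def using f(1) by (subst divide_le_eq) (auto simp: mult.commute)
    show "\<bar>\<phi> x\<bar> - 1 / real (Suc n) \<le> q n x"
      unfolding q_def using f(2) by (subst le_divide_eq) (auto simp: algebra_simps diff_divide_distrib)
  qed
  show thesis
  proof
    fix n
    have "finite (range (s n))"
    proof (rule finite_subset)
      \<comment> \<open>Each value is a sign times a grid point times 0 or 1; the bound K leaves
        finitely many grid points.\<close>
      show "range (s n) \<subseteq> (\<lambda>(a, i, b). a * (of_int i / real (Suc n)) * b) `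
          ({-1, 0, 1} \<times> {0..\<lfloor>real (Suc n) * K\<rfloor>} \<times> {0, 1})"
      proof
        fix y assume "y \<in> range (s n)"
        then obtain x where x: "y = s n x" by blast
        have "sgn (\<phi> x) \<in> {-1, 0, 1}" by (simp add: sgn_real_def)
        moreover have "\<lfloor>real (Suc n) * \<bar>\<phi> x\<bar>\<rfloor> \<in> {0..\<lfloor>real (Suc n) * K\<rfloor>}"
          using K(2)[of x] by (auto intro!: floor_mono mult_left_mono)
        moreover have "(indicator (ball 0 (real n)) x :: real) \<in> {0, 1}" by (simp add: indicator_def)
        ultimately show "y \<in> (\<lambda>(a, i, b). a * (of_int i / real (Suc n)) * b) `
            ({-1, 0, 1} \<times> {0..\<lfloor>real (Suc n) * K\<rfloor>} \<times> {0, 1})"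
          unfolding x s_def q_def
          by (intro image_eqI[where x="(sgn (\<phi> x), \<lfloor>real (Suc n) * \<bar>\<phi> x\<bar>\<rfloor>, indicator (ball 0 (real n)) x)"]) auto
      qed
    qed simp
    moreover have [measurable]: "ball 0 (real n) \<in> sets (borel :: 'a measure)" by simp
    have "s n \<in> borel_measurable borel" unfolding s_def q_def by measurable
    ultimately have "simple_function borel (s n)" by (simp add: simple_function_borel_measurable)
    moreover have "{x. s n x \<noteq> 0} \<subseteq> ball 0 (real n)" by (auto simp: s_def indicator_def split: if_splits)
    ultimately show "bounded_simple (s n)" by (auto simp: bounded_simple_def intro: bounded_subset[OF bounded_ball])
  next
    fix n x
    show "\<bar>s n x\<bar> \<le> \<bar>\<phi> x\<bar>"
      using q(1,2)[of n x] by (auto simp: s_def abs_mult indicator_def sgn_real_def)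
  next
    fix x
    have "(\<lambda>n. q n x) \<longlonglongrightarrow> \<bar>\<phi> x\<bar>"
    proof (rule tendsto_sandwich)
      show "(\<lambda>n. \<bar>\<phi> x\<bar> - 1 / real (Suc n)) \<longlonglongrightarrow> \<bar>\<phi> x\<bar>"
        using tendsto_diff[OF tendsto_const LIMSEQ_inverse_real_of_nat, of "\<bar>\<phi> x\<bar>"] by (simp add: inverse_eq_divide)
    qed (use q in auto)
    then have "(\<lambda>n. sgn (\<phi> x) * q n x) \<longlonglongrightarrow> sgn (\<phi> x) * \<bar>\<phi> x\<bar>" by (intro tendsto_intros)
    then show "(\<lambda>n. s n x) \<longlonglongrightarrow> \<phi> x"
      using tendsto_mult[OF _ indicator_Int_ball_tendsto[of UNIV x]] by (fastforce simp: s_def sgn_mult_abs)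
  qed
qed

section \<open>Existence and isometry of the integral of bounded functions\<close>

context finite_random_measure
begin

lemma rm_integrable_bounded:
  assumes \<phi>: "\<phi> \<in> bounded_measurable"
  shows "rm_integrable P M \<phi>"
proof -
  obtain K where K: "K \<ge> 0" "\<And>x. \<bar>\<phi> x\<bar> \<le> K" using bounded_measurable_bound[OF \<phi>] by metis
  have "(\<integral>\<^sup>+(x, y). ennreal (\<bar>\<phi> x\<bar> * \<bar>\<phi> y\<bar>) \<partial>T) \<le> (\<integral>\<^sup>+z. ennreal (K * K) \<partial>T)"
    using K by (intro nn_integral_mono) (auto intro!: ennreal_leI mult_mono)
  also have "\<dots> < \<infinity>" using T.emeasure_finite[of "space T"] by (auto simp: ennreal_mult_eq_top_iff less_top[symmetric])
  finally show ?thesis using \<phi> by (simp add: rm_integrable_def T_eq bounded_measurable_def)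
qed

lemma marginal_form_approximation:
  assumes \<phi>: "\<phi> \<in> bounded_measurable"
    and s: "\<And>n. bounded_simple (s n)" "\<And>x. (\<lambda>n. s n x) \<longlonglongrightarrow> \<phi> x" "\<And>n x. \<bar>s n x\<bar> \<le> \<bar>\<phi> x\<bar>"
  shows "(\<lambda>n. marginal_form (\<lambda>x. s n x - \<phi> x) (\<lambda>x. s n x - \<phi> x)) \<longlonglongrightarrow> 0"
proof -
  obtain K where K: "\<And>x. \<bar>\<phi> x\<bar> \<le> K" using bounded_measurable_bound[OF \<phi>] by metis
  show ?thesis
    by (rule marginal_form_tendsto_zero[OF bounded_simple_bounded_measurable[OF s(1)] \<phi> order_trans[OF s(3) K] s(2)])
qed

lemma marginal_form_diff_commute:
  "marginal_form (\<lambda>x. f x - g x) (\<lambda>x. f x - g x) = marginal_form (\<lambda>x. g x - f x) (\<lambda>x. g x - f x)"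
  unfolding marginal_form_def by (intro Bochner_Integration.integral_cong) (auto simp: algebra_simps)

lemma rm_simple_integral_dist_le:
  assumes \<phi>: "\<phi> \<in> bounded_measurable" and s: "bounded_simple s" and t: "bounded_simple t"
  shows "expectation (\<lambda>\<omega>. (rm_simple_integral M s \<omega> - rm_simple_integral M t \<omega>)\<^sup>2)
    \<le> 2 * marginal_form (\<lambda>x. s x - \<phi> x) (\<lambda>x. s x - \<phi> x) + 2 * marginal_form (\<lambda>x. t x - \<phi> x) (\<lambda>x. t x - \<phi> x)"
  using rm_simple_integral_dist[OF s t] marginal_form_diff_commute[of t \<phi>]
    N.form_diff_triangle[OF bounded_simple_bounded_measurable[OF s] \<phi> bounded_simple_bounded_measurable[OF t]]
  by linarith

text \<open>Y is the limit along one fixed approximation s. Any other admissible t has the same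
  limit, because the distance between the integrals of \<open>s n\<close> and \<open>t n\<close> is
  controlled by the distances of both functions from \<phi>.\<close>

lemma is_rm_integral_exists:
  assumes \<phi>: "\<phi> \<in> bounded_measurable"
  shows "\<exists>Y. is_rm_integral P M \<phi> Y"
proof -
  obtain s where s: "\<And>n::nat. bounded_simple (s n)" "\<And>x. (\<lambda>n. s n x) \<longlonglongrightarrow> \<phi> x" "\<And>n x. \<bar>s n x\<bar> \<le> \<bar>\<phi> x\<bar>"
    by (rule bounded_simple_approximation[OF \<phi>]) (rule that)
  let ?d = "\<lambda>s. marginal_form (\<lambda>x. s x - \<phi> x) (\<lambda>x. s x - \<phi> x)"
  have sd: "(\<lambda>n. ?d (s n)) \<longlonglongrightarrow> 0" by (rule marginal_form_approximation[OF \<phi> s])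
  obtain Y where Y: "square_integrable P Y"
    "(\<lambda>n. expectation (\<lambda>\<omega>. (Y \<omega> - rm_simple_integral M (s n) \<omega>)\<^sup>2)) \<longlonglongrightarrow> 0"
  proof (rule L2_complete[OF prob_space_axioms])
    show "square_integrable P (rm_simple_integral M (s n))" for n
      by (rule rm_simple_integral_square_integrable[OF s(1)])
    fix e :: real assume "e > 0"
    then obtain N where N: "\<And>n. n \<ge> N \<Longrightarrow> norm (?d (s n) - 0) < e / 4"
      using LIMSEQ_D[OF sd, of "e / 4"] by auto
    have "expectation (\<lambda>\<omega>. (rm_simple_integral M (s m) \<omega> - rm_simple_integral M (s n) \<omega>)\<^sup>2) < e"
      if "m \<ge> N" "n \<ge> N" for m n
    proof -
      have "?d (s m) < e / 4" "?d (s n) < e / 4" using N[OF that(1)] N[OF that(2)] by auto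
      then show ?thesis using rm_simple_integral_dist_le[OF \<phi> s(1) s(1), of m n] by linarith
    qed
    then show "\<exists>N. \<forall>m\<ge>N. \<forall>n\<ge>N.
        expectation (\<lambda>\<omega>. (rm_simple_integral M (s m) \<omega> - rm_simple_integral M (s n) \<omega>)\<^sup>2) < e" by blast
  qed
  have "tendsto_mean_square P (\<lambda>n. rm_simple_integral M (t n)) Y"
    if t: "\<And>n. bounded_simple (t n)" "\<And>x. (\<lambda>n. t n x) \<longlonglongrightarrow> \<phi> x" "\<And>n x. \<bar>t n x\<bar> \<le> \<bar>\<phi> x\<bar>" for t
    unfolding tendsto_mean_square_def
  proof (intro conjI allI)
    show sq: "square_integrable P (rm_simple_integral M (t n))" for n
      by (rule rm_simple_integral_square_integrable[OF t(1)])
    have td: "(\<lambda>n. ?d (t n)) \<longlonglongrightarrow> 0" by (rule marginal_form_approximation[OF \<phi> t])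
    show "(\<lambda>n. expectation (\<lambda>\<omega>. \<bar>Y \<omega> - rm_simple_integral M (t n) \<omega>\<bar>\<^sup>2)) \<longlonglongrightarrow> 0"
    proof (rule tendsto_sandwich[OF _ _ tendsto_const])
      \<comment> \<open>The triangle inequality is used twice: through the integral of
        \<open>s n\<close> for the random variables, and through \<phi> for the simple
        functions.\<close>
      let ?b = "\<lambda>n. 2 * expectation (\<lambda>\<omega>. (Y \<omega> - rm_simple_integral M (s n) \<omega>)\<^sup>2) +
        2 * (2 * ?d (s n) + 2 * ?d (t n))"
      show "?b \<longlonglongrightarrow> 0" using tendsto_add[OF tendsto_mult[OF tendsto_const[of 2] Y(2)]
          tendsto_mult[OF tendsto_const[of 2] tendsto_add[OF tendsto_mult[OF tendsto_const[of 2] sd] tendsto_mult[OF tendsto_const[of 2] td]]]]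
        by simp
      have "expectation (\<lambda>\<omega>. \<bar>Y \<omega> - rm_simple_integral M (t n) \<omega>\<bar>\<^sup>2) \<le> ?b n" for n
        using L2.form_diff_triangle[of Y "rm_simple_integral M (s n)" "rm_simple_integral M (t n)"]
          Y(1) sq[of n] rm_simple_integral_square_integrable[OF s(1), of n]
          rm_simple_integral_dist_le[OF \<phi> s(1) t(1), of n n]
        by (simp add: power2_eq_square)
      then show "\<forall>\<^sub>F n in sequentially. expectation (\<lambda>\<omega>. \<bar>Y \<omega> - rm_simple_integral M (t n) \<omega>\<bar>\<^sup>2) \<le> ?b n"
        by simp
    qed simp
  qed (rule Y(1))
  then show ?thesis using Y(1) unfolding is_rm_integral_def by blast
qed

lemma rm_integral_spec:
  assumes "\<phi> \<in> bounded_measurable"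
  shows "is_rm_integral P M \<phi> (rm_integral P M \<phi>)"
  using someI_ex[OF is_rm_integral_exists[OF assms]] rm_integrable_bounded[OF assms]
  by (simp add: rm_integral_def)

lemma rm_integral_square_integrable:
  "\<phi> \<in> bounded_measurable \<Longrightarrow> square_integrable P (rm_integral P M \<phi>)"
  using rm_integral_spec by (simp add: is_rm_integral_def)

lemma rm_integral_approximation:
  assumes \<phi>: "\<phi> \<in> bounded_measurable"
  obtains s where "\<And>n::nat. bounded_simple (s n)" "\<And>x. (\<lambda>n. s n x) \<longlonglongrightarrow> \<phi> x"
    "\<And>n x. \<bar>s n x\<bar> \<le> \<bar>\<phi> x\<bar>"
    "(\<lambda>n. expectation (\<lambda>\<omega>. (rm_simple_integral M (s n) \<omega> - rm_integral P M \<phi> \<omega>) *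
      (rm_simple_integral M (s n) \<omega> - rm_integral P M \<phi> \<omega>))) \<longlonglongrightarrow> 0"
proof -
  obtain s where s: "\<And>n::nat. bounded_simple (s n)" "\<And>x. (\<lambda>n. s n x) \<longlonglongrightarrow> \<phi> x" "\<And>n x. \<bar>s n x\<bar> \<le> \<bar>\<phi> x\<bar>"
    by (rule bounded_simple_approximation[OF \<phi>]) (rule that)
  have "tendsto_mean_square P (\<lambda>n. rm_simple_integral M (s n)) (rm_integral P M \<phi>)"
    using rm_integral_spec[OF \<phi>] s unfolding is_rm_integral_def by blast
  then have "(\<lambda>n. expectation (\<lambda>\<omega>. \<bar>rm_integral P M \<phi> \<omega> - rm_simple_integral M (s n) \<omega>\<bar>\<^sup>2)) \<longlonglongrightarrow> 0"
    by (simp add: tendsto_mean_square_def)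
  moreover have "\<bar>a - b\<bar>\<^sup>2 = (b - a) * (b - a)" for a b :: real by (simp add: power2_eq_square algebra_simps)
  ultimately show thesis using that[of s] s by simp
qed

text \<open>The isometry extends from simple functions by taking limits on both sides: joint
  continuity of the inner product for the expectations, dominated convergence for
  \<open>cov_form\<close>.\<close>

lemma rm_integral_cov:
  assumes \<phi>: "\<phi> \<in> bounded_measurable" and \<psi>: "\<psi> \<in> bounded_measurable"
  shows "expectation (\<lambda>\<omega>. rm_integral P M \<phi> \<omega> * rm_integral P M \<psi> \<omega>) = cov_form \<phi> \<psi>"
proof -
  obtain s where s: "\<And>n::nat. bounded_simple (s n)" "\<And>x. (\<lambda>n. s n x) \<longlonglongrightarrow> \<phi> x" "\<And>n x. \<bar>s n x\<bar> \<le> \<bar>\<phi> x\<bar>"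
    "(\<lambda>n. expectation (\<lambda>\<omega>. (rm_simple_integral M (s n) \<omega> - rm_integral P M \<phi> \<omega>) *
      (rm_simple_integral M (s n) \<omega> - rm_integral P M \<phi> \<omega>))) \<longlonglongrightarrow> 0"
    by (rule rm_integral_approximation[OF \<phi>]) (rule that)
  obtain t where t: "\<And>n::nat. bounded_simple (t n)" "\<And>x. (\<lambda>n. t n x) \<longlonglongrightarrow> \<psi> x" "\<And>n x. \<bar>t n x\<bar> \<le> \<bar>\<psi> x\<bar>"
    "(\<lambda>n. expectation (\<lambda>\<omega>. (rm_simple_integral M (t n) \<omega> - rm_integral P M \<psi> \<omega>) *
      (rm_simple_integral M (t n) \<omega> - rm_integral P M \<psi> \<omega>))) \<longlonglongrightarrow> 0"
    by (rule rm_integral_approximation[OF \<psi>]) (rule that)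
  obtain K L where K: "\<And>x. \<bar>\<phi> x\<bar> \<le> K" and L: "\<And>x. \<bar>\<psi> x\<bar> \<le> L"
    using bounded_measurable_bound[OF \<phi>] bounded_measurable_bound[OF \<psi>] by metis
  have "(\<lambda>n. expectation (\<lambda>\<omega>. rm_simple_integral M (s n) \<omega> * rm_simple_integral M (t n) \<omega>)) \<longlonglongrightarrow>
      expectation (\<lambda>\<omega>. rm_integral P M \<phi> \<omega> * rm_integral P M \<psi> \<omega>)"
    using s t \<phi> \<psi>
    by (intro L2.form_tendsto) (simp_all add: rm_simple_integral_square_integrable rm_integral_square_integrable)
  moreover have "(\<lambda>n. cov_form (s n) (t n)) \<longlonglongrightarrow> cov_form \<phi> \<psi>"
    by (rule cov_form_tendsto[OF bounded_simple_bounded_measurable[OF s(1)]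
          bounded_simple_bounded_measurable[OF t(1)] \<phi> \<psi>
          order_trans[OF s(3) K] order_trans[OF t(3) L] s(2) t(2)])
  ultimately show ?thesis
    using s(1) t(1) by (simp add: rm_simple_integral_cov LIMSEQ_unique)
qed

lemma expectation_rm_integral:
  assumes \<phi>: "\<phi> \<in> bounded_measurable"
  shows "expectation (rm_integral P M \<phi>) = 0"
proof -
  obtain s where s: "\<And>n::nat. bounded_simple (s n)" "\<And>x. (\<lambda>n. s n x) \<longlonglongrightarrow> \<phi> x" "\<And>n x. \<bar>s n x\<bar> \<le> \<bar>\<phi> x\<bar>"
    "(\<lambda>n. expectation (\<lambda>\<omega>. (rm_simple_integral M (s n) \<omega> - rm_integral P M \<phi> \<omega>) *
      (rm_simple_integral M (s n) \<omega> - rm_integral P M \<phi> \<omega>))) \<longlonglongrightarrow> 0"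
    by (rule rm_integral_approximation[OF \<phi>]) (rule that)
  have one: "square_integrable P (\<lambda>_. 1)" by (simp add: square_integrable_def)
  have "(\<lambda>n. expectation (\<lambda>\<omega>. rm_simple_integral M (s n) \<omega> * 1)) \<longlonglongrightarrow> expectation (\<lambda>\<omega>. rm_integral P M \<phi> \<omega> * 1)"
    using s \<phi> one
    by (intro L2.form_tendsto) (simp_all add: rm_simple_integral_square_integrable rm_integral_square_integrable)
  then have "(\<lambda>n. 0) \<longlonglongrightarrow> expectation (rm_integral P M \<phi>)"
    using expectation_rm_simple_integral[OF s(1)] by simp
  then show ?thesis by (simp add: LIMSEQ_const_iff)
qed

text \<open>Symmetry and positivity hold for the inner product of random variables and are carried
  over by \<open>rm_integral_cov\<close>.\<close>

sublocale V: semi_inner bounded_measurable cov_form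
proof
  fix \<phi> \<psi> :: "'a \<Rightarrow> real"
  assume "\<phi> \<in> bounded_measurable" "\<psi> \<in> bounded_measurable"
  then show "cov_form \<phi> \<psi> = cov_form \<psi> \<phi>" by (simp add: mult.commute flip: rm_integral_cov)
next
  fix \<phi> :: "'a \<Rightarrow> real"
  assume "\<phi> \<in> bounded_measurable"
  then show "0 \<le> cov_form \<phi> \<phi>" by (simp flip: rm_integral_cov)
qed (auto simp: bounded_measurable_zero bounded_measurable_lin cov_form_lin_left)

text \<open>Takes the place of linearity of the integral: \<open>form_diff_sum\<close> expands both
  sides into the same combination of inner products, and \<open>rm_integral_cov\<close> identifies
  these one by one.\<close>

lemma rm_integral_residual:
  assumes "finite J" "\<And>j. j \<in> J \<Longrightarrow> f j \<in> bounded_measurable" "\<phi> \<in> bounded_measurable"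
  shows "expectation (\<lambda>\<omega>. (rm_integral P M \<phi> \<omega> - (\<Sum>j\<in>J. c j * rm_integral P M (f j) \<omega>)) *
      (rm_integral P M \<phi> \<omega> - (\<Sum>j\<in>J. c j * rm_integral P M (f j) \<omega>))) =
    cov_form (\<lambda>x. \<phi> x - (\<Sum>j\<in>J. c j * f j x)) (\<lambda>x. \<phi> x - (\<Sum>j\<in>J. c j * f j x))"
  using assms
  by (subst L2.form_diff_sum, simp_all add: rm_integral_square_integrable, subst V.form_diff_sum)
     (simp_all add: rm_integral_cov)

text \<open>The functions approximable by the span form a set D that is closed under linear
  combinations and uniformly bounded pointwise limits. It contains the indicators of an
  intersection-stable generator, hence by Dynkin's argument those of all Borel sets, hence all
  bounded Borel functions.\<close>

lemma lin_span_dense: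
  assumes A: "\<And>k. A k \<in> bounded_borel" and stable: "Int_stable (range A)"
    and gen: "sets borel = sigma_sets UNIV (range A)" and balls: "\<And>n. ball 0 (real n) \<in> range A"
    and \<phi>: "\<phi> \<in> bounded_measurable" and e: "e > 0"
  shows "\<exists>u\<in>V.lin_span (\<lambda>k. indicator (A k)). marginal_form (\<lambda>x. \<phi> x - u x) (\<lambda>x. \<phi> x - u x) < e"
proof -
  let ?z = "\<lambda>k. indicator (A k) :: 'a \<Rightarrow> real"
  let ?d = "\<lambda>f g. marginal_form (\<lambda>x. f x - g x) (\<lambda>x. f x - g x)"
  define D where "D = {f \<in> bounded_measurable. \<forall>e>0. \<exists>u\<in>V.lin_span ?z. ?d f u < e}"
  have z: "?z k \<in> bounded_measurable" for k
    using A by (intro bounded_measurable_indicator bounded_borel_sets)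
  have span: "u \<in> bounded_measurable" if "u \<in> V.lin_span ?z" for u
    using that z by (rule V.lin_span_closed)
  have span_D: "u \<in> D" if "u \<in> V.lin_span ?z" for u
    using that span[OF that] N.zero_left[OF N.zero_closed] by (auto simp: D_def intro!: bexI[of _ u])
  have lin_D: "(\<lambda>x. f x + c * g x) \<in> D" if f: "f \<in> D" and g: "g \<in> D" for f g c
    unfolding D_def
  proof (intro CollectI conjI allI impI)
    have fg: "f \<in> bounded_measurable" "g \<in> bounded_measurable" using f g by (auto simp: D_def)
    then show "(\<lambda>x. f x + c * g x) \<in> bounded_measurable" by (rule bounded_measurable_lin)
    fix e :: real assume "e > 0"
    then obtain u where u: "u \<in> V.lin_span ?z" "?d f u < e / 4" using f by (auto simp: D_def dest!: spec[of _ "e/4"])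
    \<comment> \<open>The error of g is multiplied by \<open>c\<^sup>2\<close>; dividing by
      \<open>c\<^sup>2 + 1\<close> instead also covers c = 0.\<close>
    have c: "0 < c\<^sup>2 + 1" by (simp add: add_nonneg_pos)
    then obtain v where v: "v \<in> V.lin_span ?z" "?d g v < e / (4 * (c\<^sup>2 + 1))"
      using g \<open>e > 0\<close> by (auto simp: D_def dest!: spec[of _ "e / (4 * (c\<^sup>2 + 1))"])
    have uv: "u \<in> bounded_measurable" "v \<in> bounded_measurable" using u v span by auto
    have gv: "(\<lambda>x. g x - v x) \<in> bounded_measurable" using fg uv by (intro N.diff_closed)
    have cg: "?d (\<lambda>x. u x + c * g x) (\<lambda>x. u x + c * v x) = c\<^sup>2 * ?d g v"
    proof -
      have "(\<lambda>x. u x + c * g x - (u x + c * v x)) = (\<lambda>x. 0 + c * (g x - v x))" by (auto simp: algebra_simps)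
      then show ?thesis using N.form_lin[OF N.zero_closed gv, of c] N.zero_left[OF N.zero_closed] N.zero_left[OF gv]
        by simp
    qed
    have "?d (\<lambda>x. f x + c * g x) (\<lambda>x. u x + c * v x) \<le> 2 * ?d f u + 2 * (c\<^sup>2 * ?d g v)"
      using N.form_diff_triangle[of "\<lambda>x. f x + c * g x" "\<lambda>x. u x + c * g x" "\<lambda>x. u x + c * v x"] fg uv cg
      by (simp add: bounded_measurable_lin)
    also have "c\<^sup>2 * ?d g v \<le> (c\<^sup>2 + 1) * ?d g v"
      using N.nonneg[OF gv] by (intro mult_right_mono) auto
    also have "(c\<^sup>2 + 1) * ?d g v < e / 4" using v(2) c by (simp add: field_simps)
    finally have "?d (\<lambda>x. f x + c * g x) (\<lambda>x. u x + c * v x) < e" using u(2) by simp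
    then show "\<exists>u\<in>V.lin_span ?z. ?d (\<lambda>x. f x + c * g x) u < e"
      using V.lin_span_lin[OF u(1) v(1), of c] by (rule bexI)
  qed
  have lim_D: "f \<in> D" if F: "\<And>n. F n \<in> D" and K: "\<And>n x. \<bar>F n x\<bar> \<le> K" and lim: "\<And>x. (\<lambda>n. F n x) \<longlonglongrightarrow> f x"
    for F and f :: "'a \<Rightarrow> real" and K
    unfolding D_def
  proof (intro CollectI conjI allI impI)
    have Fb: "F n \<in> bounded_measurable" for n using F by (auto simp: D_def)
    have "\<bar>f x\<bar> \<le> K" for x
      using tendsto_rabs[OF lim[of x]] K by (intro LIMSEQ_le_const2) auto
    moreover have "f \<in> borel_measurable borel"
      by (rule borel_measurable_LIMSEQ_real[where u=F]) (simp_all add: lim bounded_measurable_measurable[OF Fb])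
    ultimately show fb: "f \<in> bounded_measurable" by (intro bounded_measurableI)
    fix e :: real assume "e > 0"
    have "(\<lambda>n. ?d (F n) f) \<longlonglongrightarrow> 0" by (rule marginal_form_tendsto_zero[OF Fb fb K lim])
    then obtain n where "norm (?d (F n) f - 0) < e / 4" using LIMSEQ_D[of _ 0 "e / 4"] \<open>e > 0\<close> by fastforce
    then have n: "?d f (F n) < e / 4" using marginal_form_diff_commute[of f "F n"] by simp
    obtain u where u: "u \<in> V.lin_span ?z" "?d (F n) u < e / 4" using F[of n] \<open>e > 0\<close> by (auto simp: D_def dest!: spec[of _ "e/4"])
    have "?d f u \<le> 2 * ?d f (F n) + 2 * ?d (F n) u" using fb Fb span[OF u(1)] by (rule N.form_diff_triangle)
    then have "?d f u < e" using n u(2) by linarith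
    then show "\<exists>u\<in>V.lin_span ?z. ?d f u < e" using u(1) by blast
  qed
  \<comment> \<open>Complements require the whole space, which is not among the bounded generators;
    it is reached as a limit of balls.\<close>
  have UNIV_D: "indicator UNIV \<in> D"
  proof (rule lim_D[of "\<lambda>n. indicator (ball 0 (real n))" 1])
    show "indicator (ball 0 (real n)) \<in> D" for n
    proof -
      obtain k where "ball 0 (real n) = A k" using balls[of n] by blast
      then show ?thesis using span_D[OF V.lin_span_base[of ?z k]] by simp
    qed
    show "(\<lambda>n. indicator (ball 0 (real n)) x) \<longlonglongrightarrow> (indicator UNIV x :: real)" for x :: 'a
      using indicator_Int_ball_tendsto[of UNIV x] by simp
  qed (simp add: indicator_def)
  have empty_D: "indicator {} \<in> D"
    using span_D[OF V.lin_span.zero] by (simp add: indicator_def[abs_def])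
  have range_A: "range A \<subseteq> Pow UNIV" by simp
  have ind_D: "indicator B \<in> D" if "B \<in> sigma_sets UNIV (range A)" for B
    using stable range_A that
  proof (induction B rule: sigma_sets_induct_disjoint)
    case (basic B)
    then show ?case using span_D[OF V.lin_span_base[of ?z]] by auto
  next
    case (compl B)
    have "indicator (UNIV - B) = (\<lambda>x. indicator UNIV x + (-1) * indicator B x :: real)"
      by (auto simp: indicator_def)
    then show ?case using lin_D[OF UNIV_D compl.IH, of "-1"] by simp
  next
    case (union B)
    show ?case
    proof (rule lim_D[of "\<lambda>n x. \<Sum>i<n. indicator (B i) x" 1])
      show "(\<lambda>x. \<Sum>i<n. indicator (B i) x) \<in> D" for n
      proof (induction n)
        case (Suc n)
        then show ?case using lin_D[OF Suc union.IH[of n], of 1] by simp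
      qed (use empty_D in \<open>simp add: indicator_def[abs_def]\<close>)
      show "\<bar>\<Sum>i<n. indicator (B i) x\<bar> \<le> (1::real)" for n x
      proof -
        have "(\<Sum>i<n. indicator (B i) x) = (indicator (\<Union>i<n. B i) x :: real)"
          using union.hyps(1) by (intro indicator_UN_disjoint[symmetric]) (auto simp: disjoint_family_on_def)
        then show ?thesis by (simp add: indicator_def)
      qed
      show "(\<lambda>n. \<Sum>i<n. indicator (B i) x) \<longlonglongrightarrow> (indicator (\<Union>i. B i) x :: real)" for x
        using indicator_sums[of B x] union.hyps(1) by (auto simp: sums_def disjoint_family_on_def)
    qed
  qed (rule empty_D)
  from \<phi> have "\<phi> \<in> D"
  proof (induction rule: bounded_measurable_induct)
    case (indicator B)
    then show ?case using ind_D gen by auto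
  next
    case (lim F f K)
    show ?case by (rule lim_D[OF lim.IH lim.hyps(2,3)])
  qed (rule lin_D)
  then show ?thesis using e by (simp add: D_def)
qed

end

text \<open>Finite intersections of basic open sets, cut down by balls of integer radius. Cutting
  makes them bounded and preserves stability, since two concentric balls meet in the smaller one;
  the empty family yields the balls themselves.\<close>

lemma countable_bounded_generator:
  obtains A :: "nat \<Rightarrow> 'a::euclidean_space set"
  where "\<And>k. A k \<in> bounded_borel" "Int_stable (range A)"
    "sets borel = sigma_sets UNIV (range A)" "\<And>n. ball 0 (real n) \<in> range A"
proof -
  obtain B :: "'a set set" where B: "countable B" "topological_basis B"
    using ex_countable_basis by blast
  define G where "G = (\<lambda>(F, n). \<Inter>F \<inter> ball 0 (real n)) ` ({F. finite F \<and> F \<subseteq> B} \<times> UNIV)"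
  have "countable G" unfolding G_def
    using B(1) by (intro countable_image countable_SIGMA countable_Collect_finite_subset) auto
  have GI: "\<Inter>F \<inter> ball 0 (real n) \<in> G" if "finite F" "F \<subseteq> B" for F n
    unfolding G_def using that by (intro image_eqI[where x="(F, n)"]) auto
  have opn: "open U \<and> bounded U" if "U \<in> G" for U
    using that topological_basis_open[OF B(2)]
    by (auto simp: G_def intro!: open_Int open_Inter intro: bounded_subset[OF bounded_ball])
  have "G \<noteq> {}" using GI[of "{}"] by blast
  then have range: "range (from_nat_into G) = G" using \<open>countable G\<close> by (rule range_from_nat_into)
  show thesis
  proof (rule that[of "from_nat_into G"], unfold range)
    show "from_nat_into G k \<in> bounded_borel" for k
      using opn[OF from_nat_into[OF \<open>G \<noteq> {}\<close>]] by (auto simp: bounded_borel_def)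
    show "ball 0 (real n) \<in> G" for n using GI[of "{}" n] by simp
    show "Int_stable G"
    proof (rule Int_stableI)
      fix U V assume "U \<in> G" "V \<in> G"
      then obtain F F' n n' where F: "finite F" "F \<subseteq> B" "U = \<Inter>F \<inter> ball 0 (real n)"
        "finite F'" "F' \<subseteq> B" "V = \<Inter>F' \<inter> ball 0 (real n')"
        by (auto simp: G_def)
      have "U \<inter> V = \<Inter>(F \<union> F') \<inter> ball 0 (real (min n n'))" using F by auto
      then show "U \<inter> V \<in> G" using GI[of "F \<union> F'" "min n n'"] F by simp
    qed
    show "sets borel = sigma_sets UNIV G"
    proof
      have "U \<in> sigma_sets UNIV G" if "U \<in> B" for U
      proof -
        have "U \<inter> ball 0 (real n) \<in> G" for n using GI[of "{U}" n] that by simp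
        then have "(\<Union>n. U \<inter> ball 0 (real n)) \<in> sigma_sets UNIV G" by (intro sigma_sets.Union sigma_sets.Basic)
        then show ?thesis by (simp only: UN_Int_ball)
      qed
      then have "sigma_sets UNIV B \<subseteq> sigma_sets UNIV G" by (intro sigma_sets_mono) auto
      then show "sets borel \<subseteq> sigma_sets UNIV G"
        by (simp add: borel_eq_countable_basis[OF B])
      show "sigma_sets UNIV G \<subseteq> sets borel"
        using sets.sigma_sets_subset[of G "borel :: 'a measure"] opn by (simp add: subset_iff)
    qed
  qed
qed

section \<open>The orthogonal expansion\<close>

context finite_random_measure
begin

text \<open>A finite measure has at most countably many atoms, while the space is uncountable.
  Points that are not atoms of the first marginal of T are invisible to \<open>cov_form\<close>, so
  Dirac measures there do not interfere with the measures built from it.\<close>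

lemma nonatomic_points:
  obtains x :: "nat \<Rightarrow> 'a"
  where "inj x" "\<And>k \<psi>. \<psi> \<in> bounded_measurable \<Longrightarrow> cov_form (indicator {x k}) \<psi> = 0"
proof -
  interpret D: finite_measure "distr T borel fst" by (rule T.finite_measure_distr) simp
  let ?S = "UNIV - {x. measure (distr T borel fst) {x} \<noteq> 0}"
  have "uncountable (UNIV :: 'a set)"
    using uncountable_ball[of 1 "0 :: 'a"] countable_subset[OF subset_UNIV] by auto
  then have "uncountable ?S" by (intro uncountable_minus_countable D.countable_support)
  then have "infinite ?S" by (rule uncountable_infinite)
  then obtain x :: "nat \<Rightarrow> 'a" where x: "inj x" "range x \<subseteq> ?S"
    using infinite_countable_subset by metis
  have "cov_form (indicator {x k}) \<psi> = 0" for k \<psi>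
  proof -
    have "measure (distr T borel fst) {x k} = 0" using x(2) by auto
    then have "emeasure (distr T borel fst) {x k} = 0" by (simp add: D.emeasure_eq_measure)
    then have "emeasure T (fst -` {x k} \<inter> space T) = 0" by (simp add: emeasure_distr)
    moreover have "fst -` {x k} \<inter> space T \<in> sets T" by (rule measurable_sets[OF fst_measurable]) simp
    ultimately have "AE z in T. fst z \<noteq> x k"
      by (subst AE_iff_measurable[where N="fst -` {x k} \<inter> space T"]) auto
    then show ?thesis
      unfolding cov_form_def by (intro integral_eq_zero_AE) (auto elim!: eventually_mono)
  qed
  then show thesis using x(1) that by blast
qed

lemma orthogonal_expansion:
  obtains X :: "nat \<Rightarrow> 'w \<Rightarrow> real" and \<mu> :: "nat \<Rightarrow> 'a set \<Rightarrow> real"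
  where "\<And>n. square_integrable P (X n)" "\<And>m n. m \<noteq> n \<Longrightarrow> uncorrelated P (X m) (X n)"
    "summable (\<lambda>n. variance (X n))" "\<And>n. finite_signed_measure (\<mu> n)" "lin_indep_measures \<mu>"
    "\<And>\<phi>. \<phi> \<in> bounded_measurable \<Longrightarrow>
      tendsto_mean_square P (\<lambda>n \<omega>. \<Sum>j\<le>n. X j \<omega> * signed_integral (\<mu> j) \<phi>) (rm_integral P M \<phi>)"
proof -
  obtain A :: "nat \<Rightarrow> 'a set" where A: "\<And>k. A k \<in> bounded_borel" and A': "Int_stable (range A)"
    "sets borel = sigma_sets UNIV (range A)" "\<And>n. ball 0 (real n) \<in> range A"
    by (rule countable_bounded_generator) (rule that)
  obtain x :: "nat \<Rightarrow> 'a" where x: "inj x"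
    "\<And>k \<psi>. \<psi> \<in> bounded_measurable \<Longrightarrow> cov_form (indicator {x k}) \<psi> = 0"
    by (rule nonatomic_points) (rule that)
  define z :: "nat \<Rightarrow> 'a \<Rightarrow> real" where "z k = indicator (A k)" for k
  have z: "z k \<in> bounded_measurable" for k
    unfolding z_def using A by (intro bounded_measurable_indicator bounded_borel_sets)
  have dense: "\<exists>u\<in>V.lin_span z. cov_form (\<lambda>x. \<phi> x - u x) (\<lambda>x. \<phi> x - u x) < e"
    if \<phi>: "\<phi> \<in> bounded_measurable" and e: "e > 0" for \<phi> e
  proof -
    obtain u where u: "u \<in> V.lin_span z" "marginal_form (\<lambda>x. \<phi> x - u x) (\<lambda>x. \<phi> x - u x) < e"
      using lin_span_dense[OF A A' \<phi> e] unfolding z_def[abs_def] by blast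
    have "u \<in> bounded_measurable" using u(1) z by (rule V.lin_span_closed)
    then have "cov_form (\<lambda>x. \<phi> x - u x) (\<lambda>x. \<phi> x - u x) \<le> marginal_form (\<lambda>x. \<phi> x - u x) (\<lambda>x. \<phi> x - u x)"
      by (intro cov_form_le V.diff_closed \<phi>)
    then show ?thesis using u by (intro bexI[of _ u]) auto
  qed
  define f where "f = V.gram_schmidt z"
  have f: "f k \<in> bounded_measurable" for k unfolding f_def using z by (rule V.gram_schmidt_closed)
  have orth: "cov_form (f i) (f j) = 0" if "i \<noteq> j" for i j
    unfolding f_def using z that by (rule V.gram_schmidt_orthogonal)
  define q where "q k = cov_form (f k) (f k)" for k
  have q: "q k \<ge> 0" for k unfolding q_def using f by (rule V.nonneg)
  \<comment> \<open>Splitting 1 / q k evenly between a and b makes the variance of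
    \<open>X k\<close> exactly \<open>(1/4)^k\<close> whenever q k is nonzero, however small q k is.
    For q k = 0 both constants are 0.\<close>
  define a where "a k = (1/2)^k / sqrt (q k)" for k
  define b where "b k = 2^k / sqrt (q k)" for k
  have ab: "a k * b k = 1 / q k" for k
    using q[of k] by (simp add: a_def b_def power_one_over)
  define X where "X k \<omega> = a k * rm_integral P M (f k) \<omega>" for k \<omega>
  text \<open>Where \<open>f k\<close> is degenerate, \<open>X k\<close> vanishes since \<open>a k = 0\<close>, and \<open>\<mu> k\<close> only has to preserve
    linear independence: a Dirac measure at a point that none of the other measures charges.\<close>
  define \<mu> where "\<mu> k B = (if q k = 0 then indicator B (x k) else b k * cov_form (indicator B) (f k))" for k B
  have Xsq: "square_integrable P (X k)" for k
    unfolding X_def using L2.scale_closed[of "rm_integral P M (f k)" "a k"] rm_integral_square_integrable[OF f] by simp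
  have X0: "expectation (X k) = 0" for k
    unfolding X_def using expectation_rm_integral[OF f] by simp
  have XX: "expectation (\<lambda>\<omega>. X m \<omega> * X n \<omega>) = a m * a n * cov_form (f m) (f n)" for m n
  proof -
    have "expectation (\<lambda>\<omega>. X m \<omega> * X n \<omega>) =
        expectation (\<lambda>\<omega>. (a m * a n) * (rm_integral P M (f m) \<omega> * rm_integral P M (f n) \<omega>))"
      unfolding X_def by (intro Bochner_Integration.integral_cong) auto
    then show ?thesis by (simp add: rm_integral_cov[OF f f])
  qed
  have \<mu>_density: "finite_signed_measure (\<mu> k)"
    "q k \<noteq> 0 \<Longrightarrow> \<phi> \<in> bounded_measurable \<Longrightarrow> signed_integral (\<mu> k) \<phi> = b k * cov_form \<phi> (f k)" for k \<phi>
  proof -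
    have i: "integrable T (\<lambda>y. b k * (f k (snd y) * h y))"
      using integrable_cov_form[OF bounded_measurable_indicator[of UNIV] f[of k]] by simp
    have m: "\<psi> (fst y) * (b k * (f k (snd y) * h y)) = b k * (\<psi> (fst y) * (f k (snd y) * h y))" for \<psi> y
      by simp
    have eq: "\<mu> k B = (\<integral>y. indicator B (fst y) * (b k * (f k (snd y) * h y)) \<partial>T)" if "q k \<noteq> 0" for B
      using that unfolding m by (simp add: \<mu>_def cov_form_def)
    show "finite_signed_measure (\<mu> k)"
    proof (cases "q k = 0")
      case True
      \<comment> \<open>The Dirac measure at \<open>x k\<close> is the image of the probability
        measure P under a constant map.\<close>
      show ?thesis
        by (rule finite_signed_measure_density(1)[where L=P and p="\<lambda>_. x k" and g="\<lambda>_. 1"])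
           (auto simp: \<mu>_def True prob_space)
    next
      case False
      show ?thesis by (rule finite_signed_measure_density(1)[OF fst_measurable i eq[OF False]])
    qed
    show "signed_integral (\<mu> k) \<phi> = b k * cov_form \<phi> (f k)" if "q k \<noteq> 0" "\<phi> \<in> bounded_measurable"
      using finite_signed_measure_density(2)[OF fst_measurable i eq[OF that(1)] that(2)] unfolding m
      by (simp add: cov_form_def)
  qed
  show thesis
  proof (rule that[of X \<mu>])
    show "uncorrelated P (X m) (X n)" if "m \<noteq> n" for m n
      using orth[OF that] by (simp add: uncorrelated_def X0 XX)
    show "summable (\<lambda>n. variance (X n))"
    proof (rule summable_comparison_test'[of "\<lambda>n. (1/4::real)^n"])
      fix n
      have "variance (X n) = a n * a n * q n" by (simp add: X0 power2_eq_square XX q_def)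
      also have "\<dots> \<le> (1/4)^n"
        using q[of n] by (auto simp: a_def simp flip: power_mult_distrib)
      finally show "norm (variance (X n)) \<le> (1/4)^n" by simp
    qed simp
    show "lin_indep_measures \<mu>"
      unfolding lin_indep_measures_def
    proof (intro allI impI)
      fix c :: "nat \<Rightarrow> real" and n i
      assume zero: "\<forall>B\<in>bounded_borel. (\<Sum>i<n. c i * \<mu> i B) = 0" and i: "i < n"
      have deg: "c i = 0" if "i < n" "q i = 0" for i
      \<comment> \<open>Testing on {x i} isolates one Dirac measure: the others sit at different
        points, and the measures coming from \<open>cov_form\<close> do not charge
        \<open>x i\<close>.\<close>
      proof -
        have "{x i} \<in> bounded_borel" by (simp add: bounded_borel_def)
        then have "0 = (\<Sum>j<n. c j * \<mu> j {x i})" using zero by simp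
        also have "\<dots> = (\<Sum>j<n. if j = i then c i else 0)"
          using x(1) that(2) x(2)[OF f] by (intro sum.cong) (auto simp: \<mu>_def indicator_def dest: injD)
        finally show ?thesis using that(1) by (simp add: sum.delta)
      qed
      \<comment> \<open>The nondegenerate measures combine to B \<mapsto>
        \<open>cov_form (indicator B) g\<close>. As this vanishes on all \<open>A k\<close>, g is
        orthogonal to a dense span and has length zero, while pairing g with \<open>f i\<close>
        recovers \<open>d i * q i\<close>.\<close>
      define d where "d j = (if q j = 0 then 0 else c j * b j)" for j
      define g where "g y = (\<Sum>j<n. d j * f j y)" for y
      have g: "g \<in> bounded_measurable" unfolding g_def using f by (intro V.sum_closed) auto
      have fg: "cov_form g (f i) = d i * q i" if "i < n" for i
      proof -
        have "cov_form g (f i) = (\<Sum>j<n. d j * cov_form (f j) (f i))"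
          unfolding g_def using f by (intro V.sum_left) auto
        also have "\<dots> = (\<Sum>j<n. if j = i then d i * q i else 0)"
          using orth by (intro sum.cong) (auto simp: q_def)
        finally show ?thesis using that by (simp add: sum.delta)
      qed
      have "cov_form (z k) g = 0" for k
      proof -
        have "cov_form (z k) g = (\<Sum>j<n. d j * cov_form (z k) (f j))"
          unfolding g_def using f z by (intro cov_form_sum_right) auto
        also have "\<dots> = (\<Sum>j<n. c j * \<mu> j (A k))"
          using deg by (intro sum.cong) (auto simp: d_def \<mu>_def z_def)
        finally show ?thesis using zero A by simp
      qed
      then have gz: "cov_form g (z k) = 0" for k using V.sym[OF g z] by simp
      have gu: "cov_form g u = 0" if "u \<in> V.lin_span z" for u
        using V.lin_span_orthogonal[OF that z] g gz by blast
      \<comment> \<open>Since g is orthogonal to u, the squared length of g - u is the sum of those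
        of g and u and therefore bounds that of g.\<close>
      have "cov_form g g \<le> e" if "e > 0" for e
      proof -
        obtain u where u: "u \<in> V.lin_span z" "cov_form (\<lambda>x. g x - u x) (\<lambda>x. g x - u x) < e"
          using dense[OF g \<open>e > 0\<close>] by blast
        have uV: "u \<in> bounded_measurable" using u(1) z by (rule V.lin_span_closed)
        show ?thesis using u(2) V.form_diff[OF g uV] gu[OF u(1)] V.nonneg[OF uV] by simp
      qed
      then have "cov_form g g \<le> 0" by (rule field_le_epsilon[of "cov_form g g" 0, simplified])
      then have "cov_form g g = 0" using V.nonneg[OF g] by simp
      then have "cov_form (f i) g = 0" by (rule V.form_degenerate[OF f g])
      then have "d i * q i = 0" using fg[OF i] V.sym[OF f g] by simp
      then show "c i = 0" using deg[OF i] q[of i] by (auto simp: d_def b_def split: if_splits)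
    qed
  next
    fix \<phi> :: "'a \<Rightarrow> real" assume \<phi>: "\<phi> \<in> bounded_measurable"
    have term_eq: "X j \<omega> * signed_integral (\<mu> j) \<phi> =
        (cov_form \<phi> (f j) / cov_form (f j) (f j)) * rm_integral P M (f j) \<omega>" for j \<omega>
    proof (cases "q j = 0")
      case True
      then show ?thesis by (simp add: X_def a_def flip: q_def)
    next
      case False
      have "X j \<omega> * signed_integral (\<mu> j) \<phi> = (a j * b j) * cov_form \<phi> (f j) * rm_integral P M (f j) \<omega>"
        using \<mu>_density(2)[OF False \<phi>] by (simp add: X_def)
      then show ?thesis by (simp add: ab flip: q_def)
    qed
    have "(\<lambda>\<omega>. \<Sum>j\<le>n. (cov_form \<phi> (f j) / cov_form (f j) (f j)) * rm_integral P M (f j) \<omega>) \<in> {X. square_integrable P X}" for n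
      using f by (intro L2.sum_closed) (auto intro: rm_integral_square_integrable)
    moreover have "(\<lambda>n. expectation (\<lambda>\<omega>. \<bar>rm_integral P M \<phi> \<omega> -
        (\<Sum>j\<le>n. (cov_form \<phi> (f j) / cov_form (f j) (f j)) * rm_integral P M (f j) \<omega>)\<bar>\<^sup>2)) \<longlonglongrightarrow> 0"
    proof -
      have "(\<lambda>n. cov_form (\<lambda>x. \<phi> x - (\<Sum>j<n. (cov_form \<phi> (f j) / cov_form (f j) (f j)) * f j x))
          (\<lambda>x. \<phi> x - (\<Sum>j<n. (cov_form \<phi> (f j) / cov_form (f j) (f j)) * f j x))) \<longlonglongrightarrow> 0"
        unfolding f_def by (rule V.gram_schmidt_expansion[OF z \<phi> dense[OF \<phi>]])
      \<comment> \<open>The expansion sums over \<open>j < n\<close>, the claim over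
        \<open>j \<le> n\<close>, hence the shift by one.\<close>
      from LIMSEQ_Suc[OF this] show ?thesis
        unfolding lessThan_Suc_atMost power2_abs unfolding power2_eq_square
        by (subst rm_integral_residual[OF _ f \<phi>]) simp_all
    qed
    ultimately show "tendsto_mean_square P (\<lambda>n \<omega>. \<Sum>j\<le>n. X j \<omega> * signed_integral (\<mu> j) \<phi>) (rm_integral P M \<phi>)"
      unfolding term_eq tendsto_mean_square_def using rm_integral_square_integrable[OF \<phi>] by simp
  qed (rule Xsq \<mu>_density(1))+
qed

end

section \<open>From a finite random measure to the locale, and the theorem\<close>

lemma bounded_borel_Times:
  fixes A B :: "'a::euclidean_space set"
  assumes "A \<in> bounded_borel" "B \<in> bounded_borel"
  shows "A \<times> B \<in> bounded_borel"
proof -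
  have "A \<times> B \<in> sets borel"
    unfolding borel_prod[symmetric] using assms by (intro pair_measureI bounded_borel_sets)
  moreover have "bounded (A \<times> B)" using assms by (simp add: bounded_borel_def bounded_Times)
  ultimately show ?thesis by (simp only: bounded_borel_def mem_Collect_eq)
qed

text \<open>\<open>covariance_measure\<close> is a choice among covariance measures, so its property
  has to be retrieved first; the Jordan density evaluated on bounded rectangles then gives
  \<open>M_cov\<close>.\<close>

lemma finite_random_measureI:
  fixes M :: "'a::euclidean_space set \<Rightarrow> 'w \<Rightarrow> real"
  assumes "prob_space P" "finite_mcov_random_measure P M"
  obtains T h where "finite_random_measure P M T h"
proof -
  interpret prob_space P by fact
  let ?C = "covariance_measure P M"
  have mcov: "mcov_random_measure P M" and fin: "finite_signed_measure ?C"
    using assms(2) by (auto simp: finite_mcov_random_measure_def)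
  have "\<exists>C. is_covariance_measure P M C" using mcov by (simp add: mcov_random_measure_def)
  then have cov: "is_covariance_measure P M ?C" unfolding covariance_measure_def by (rule someI_ex)
  obtain h where h: "sets (total_variation ?C) = sets borel" "finite_measure (total_variation ?C)"
    "h \<in> borel_measurable borel" "\<And>x. \<bar>h x\<bar> \<le> 1"
    "\<And>A. A \<in> bounded_borel \<Longrightarrow> ?C A = (\<integral>x. indicator A x * h x \<partial>total_variation ?C)"
    by (rule finite_signed_measure_jordan[OF fin]) (rule that)
  have "finite_random_measure P M (total_variation ?C) h"
  proof (intro finite_random_measure.intro finite_random_measure_axioms.intro prob_space_axioms)
    fix A B :: "'a set" assume AB: "A \<in> bounded_borel" "B \<in> bounded_borel"
    show "expectation (\<lambda>\<omega>. M A \<omega> * M B \<omega>) = (\<integral>z. indicator (A \<times> B) z * h z \<partial>total_variation ?C)"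
      using cov AB h(5)[OF bounded_borel_Times[OF AB]] by (simp add: is_covariance_measure_def)
  qed (use mcov h(1-4) in \<open>simp_all add: mcov_random_measure_def\<close>)
  then show thesis by (rule that)
qed

theorem theorem3p1:
  fixes P :: "'w measure"
    and M :: "(real ^ 'd) set \<Rightarrow> 'w \<Rightarrow> real"
  assumes "prob_space P"
    and "finite_mcov_random_measure P M"
  shows "\<exists>(X :: nat \<Rightarrow> 'w \<Rightarrow> real) (\<mu> :: nat \<Rightarrow> (real ^ 'd) set \<Rightarrow> real).
      (\<forall>n. square_integrable P (X n)) \<and>
      (\<forall>m n. m \<noteq> n \<longrightarrow> uncorrelated P (X m) (X n)) \<and>
      summable (\<lambda>n. prob_space.variance P (X n)) \<and>
      (\<forall>n. finite_signed_measure (\<mu> n)) \<and>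
      lin_indep_measures \<mu> \<and>
      (\<forall>\<phi> :: real ^ 'd \<Rightarrow> real. \<phi> \<in> borel_measurable borel \<longrightarrow> bounded (range \<phi>) \<longrightarrow>
         tendsto_mean_square P
           (\<lambda>n \<omega>. \<Sum>j\<le>n. X j \<omega> * signed_integral (\<mu> j) \<phi>)
           (rm_integral P M \<phi>))"
proof -
  obtain T h where "finite_random_measure P M T h"
    by (rule finite_random_measureI[OF assms]) (rule that)
  then interpret finite_random_measure P M T h .
  obtain X \<mu> where "\<And>n. square_integrable P (X n)" "\<And>m n. m \<noteq> n \<Longrightarrow> uncorrelated P (X m) (X n)"
    "summable (\<lambda>n. variance (X n))" "\<And>n. finite_signed_measure (\<mu> n)" "lin_indep_measures \<mu>"
    "\<And>\<phi>. \<phi> \<in> bounded_measurable \<Longrightarrow>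
      tendsto_mean_square P (\<lambda>n \<omega>. \<Sum>j\<le>n. X j \<omega> * signed_integral (\<mu> j) \<phi>) (rm_integral P M \<phi>)"
    by (rule orthogonal_expansion) (rule that)
  then show ?thesis
    by (intro exI[of _ X] exI[of _ \<mu>] conjI allI impI) (simp_all add: bounded_measurable_def)
qed

end
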